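(* Let $X\neq\{0\}$ be a real Hilbert space, let $m\in\mathbb{N}$, let $m_1,\dots,m_m\in\mathbb{N}$, and for $i\in\{1,\dots,m\}$, $j\in\{1,\dots,m_i\}$ let $\Omega_{i,j}\subseteq X$ be closed and convex sets such that $\Omega_i:=\bigcap_{j=1}^{m_i}\Omega_{i,j}\neq\emptyset$ for all $i\in\{1,\dots,m\}$. Let $\Omega_{m+1}\subseteq X$ be nonempty, closed and convex, and let $(\beta_i)_{i=1}^m$ be a positive weight vector. Let $(\tau_{i,t})_{t=0}^\infty$ be steering parameter sequences and $w_i=(w_{i,j})_{j=1}^{m_i}$ positive weight vectors ($i\in\{1,\dots,m\}$), and let $(\lambda_k)_{k=0}^\infty$, $(\gamma_k)_{k=0}^\infty$ be sequences in $(0,1]$. Consider the minimization problem $$(\ast)\qquad \min_{x\in\Omega_{m+1}}\ \frac12\sum_{i=1}^m\beta_i\, d(x,\Omega_i)^2 .$$ (1) Suppose that either $\Omega_{m+1}$ is bounded, or $\Omega_{m+1}$ is unbounded and $\Omega_q$ is bounded for some $q\in\{1,\dots,m\}$. Then $(\ast)$ has at least one solution. (2) If, in addition to the assumption of (1), $\Omega_s$ is strictly convex for some $s\in\{1,\dots,m\}$ and also $\Omega_s\cap\Omega_{m+1}=\emptyset$, then $(\ast)$ has a unique solution $x^*$, and $x^*$ is also the unique fixed point of each of the functions $G_{\lambda,\gamma}:X\to X$, $\lambda\in(0,1]$, $\gamma\in(0,2)$, defined by $$G_{\lambda,\gamma}(x):=(1-\lambda)x+\lambda P_{m+1}\Big((1-\gamma)x+\gamma\sum_{i=1}^m\beta_iP_i(x)\Big),\qquad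 x\in X.$$ (3) Assume further that $X$ is finite-dimensional, that there is some $\rho>0$ such that $\Omega_{m+1}\cup\big(\bigcup_{i=1}^m\bigcup_{j=1}^{m_i}\Omega_{i,j}\big)\subseteq B[0,\rho]$, that $\Omega_i$ is strictly convex and satisfies $\Omega_i\cap\Omega_{m+1}=\emptyset$ for each $i\in\{1,\dots,m\}$, and that the limits $\lambda_\infty:=\lim_{k\to\infty}\lambda_k$ and $\gamma_\infty:=\lim_{k\to\infty}\gamma_k$ exist and satisfy $\lambda_\infty>0$ and $\gamma_\infty>0$. If $x^0\in\Omega_{m+1}$, then any sequence $(x^k)_{k=0}^\infty$ generated from $x^0$ by $$x^{k+1}:=(1-\lambda_k)x^k+\lambda_kP_{m+1}\Big((1-\gamma_k)x^k+\gamma_k\sum_{i=1}^m\beta_i\widehat P_{i,k}(x^k)\Big),\qquad k\in\mathbb{N}\cup\{0\},$$ is contained in $\Omega_{m+1}$ and converges to $x^*$.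
   Context: $\mathbb{N}=\{1,2,\dots\}$. For a nonempty set $S\subseteq X$, $d(x,S):=\inf\{\|x-y\| : y\in S\}$. $B[0,\rho]$ is the closed ball of radius $\rho$ about $0$. For a nonempty closed convex $S\subseteq X$, the orthogonal projection of $x$ onto $S$ is the unique point of $S$ at distance $d(x,S)$ from $x$. $P_i$ denotes the orthogonal projection onto $\Omega_i$ ($i\in\{1,\dots,m+1\}$), and $P_{i,j}$ the orthogonal projection onto $\Omega_{i,j}$ ($i\in\{1,\dots,m\}$, $j\in\{1,\dots,m_i\}$). A set $S\subseteq X$ is strictly convex if for all distinct $a,b\in S$ the open segment $(a,b)$ is contained in the interior of $S$. A positive weight vector is a vector of strictly positive real numbers whose sum is $1$. A steering parameter sequence is a sequence $(\tau_k)_{k=0}^\infty$ with $\tau_k\in(0,1)$ for all $k\ge 0$, $\lim_{k\to\infty}\tau_k=0$, $\sum_{k=0}^\infty\tau_k=\infty$ and $\sum_{k=0}^\infty|\tau_{k+1}-\tau_k|<\infty$. Approximate projections: for $i\in\{1,\dots,m\}$, $k\in\mathbb{N}\cup\{0\}$ and $x\in X$, put $y^0:=x$ and, for $t=0,1,\dots,k$, $y^{t+1}:=\tau_{i,t}\,x+(1-\tau_{i,t})\sum_{j=1}^{m_i}w_{i,j}P_{i,j}(y^t)$ (the anchor $x$ is kept fixed during these steps); then $\widehat P_{i,k}(x):=y^{k+1}$. *)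

theory Defs
  imports "HOL-Analysis.Analysis"
begin

text \<open>A Hilbert space is a type of sort \<open>{real_inner, complete_space}\<close>.
  The library's \<open>closest_point\<close> is restricted to Heine--Borel (hence finite-dimensional) spaces,
  so the projection is defined here. The description is proper only if \<open>S\<close> is nonempty, closed
  and convex.\<close>

definition proj :: "'a::{real_inner,complete_space} set \<Rightarrow> 'a \<Rightarrow> 'a" where
  "proj S x = (THE y. y \<in> S \<and> dist x y = infdist x S)"

definition strictly_convex :: "'a::real_normed_vector set \<Rightarrow> bool" where
  "strictly_convex S \<longleftrightarrow>
     (\<forall>a\<in>S. \<forall>b\<in>S. a \<noteq> b \<longrightarrow> open_segment a b \<subseteq> interior S)"

text \<open>Vectors of length \<open>n\<close> are functions on \<open>nat\<close> of which only the values at \<open>1, \<dots>, n\<close> matter.\<close>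

definition positive_weights :: "nat \<Rightarrow> (nat \<Rightarrow> real) \<Rightarrow> bool" where
  "positive_weights n w \<longleftrightarrow> (\<forall>i\<in>{1..n}. 0 < w i) \<and> (\<Sum>i=1..n. w i) = 1"

definition steering_sequence :: "(nat \<Rightarrow> real) \<Rightarrow> bool" where
  "steering_sequence \<tau> \<longleftrightarrow>
     (\<forall>k. 0 < \<tau> k \<and> \<tau> k < 1) \<and>
     \<tau> \<longlonglongrightarrow> 0 \<and>
     filterlim (\<lambda>n. \<Sum>k<n. \<tau> k) at_top sequentially \<and>
     summable (\<lambda>k. \<bar>\<tau> (Suc k) - \<tau> k\<bar>)"

primrec anchored_iter ::
  "nat \<Rightarrow> (nat \<Rightarrow> 'a::{real_inner,complete_space} set) \<Rightarrow> (nat \<Rightarrow> real) \<Rightarrow> (nat \<Rightarrow> real) \<Rightarrow> 'a \<Rightarrow> nat \<Rightarrow> 'a"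
where
  "anchored_iter n C w \<tau> x 0 = x"
| "anchored_iter n C w \<tau> x (Suc t) =
     \<tau> t *\<^sub>R x + (1 - \<tau> t) *\<^sub>R (\<Sum>j=1..n. w j *\<^sub>R proj (C j) (anchored_iter n C w \<tau> x t))"

text \<open>The approximate projection onto \<open>C 1 \<inter> \<dots> \<inter> C n\<close> of index \<open>k\<close> performs \<open>k + 1\<close> steps.\<close>

definition approx_proj ::
  "nat \<Rightarrow> (nat \<Rightarrow> 'a::{real_inner,complete_space} set) \<Rightarrow> (nat \<Rightarrow> real) \<Rightarrow> (nat \<Rightarrow> real) \<Rightarrow> nat \<Rightarrow> 'a \<Rightarrow> 'a"
where
  "approx_proj n C w \<tau> k x = anchored_iter n C w \<tau> x (Suc k)"

definition proximity ::
  "nat \<Rightarrow> (nat \<Rightarrow> 'a::real_normed_vector set) \<Rightarrow> (nat \<Rightarrow> real) \<Rightarrow> 'a \<Rightarrow> real"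
where
  "proximity m \<Omega> \<beta> x = 1/2 * (\<Sum>i=1..m. \<beta> i * (infdist x (\<Omega> i))\<^sup>2)"

definition is_solution ::
  "nat \<Rightarrow> (nat \<Rightarrow> 'a::real_normed_vector set) \<Rightarrow> (nat \<Rightarrow> real) \<Rightarrow> 'a \<Rightarrow> bool"
where
  "is_solution m \<Omega> \<beta> x \<longleftrightarrow> is_arg_min (proximity m \<Omega> \<beta>) (\<lambda>y. y \<in> \<Omega> (m + 1)) x"

definition G_map ::
  "nat \<Rightarrow> (nat \<Rightarrow> 'a::{real_inner,complete_space} set) \<Rightarrow> (nat \<Rightarrow> real) \<Rightarrow> real \<Rightarrow> real \<Rightarrow> 'a \<Rightarrow> 'a"
where
  "G_map m \<Omega> \<beta> l g x =
     (1 - l) *\<^sub>R x +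
     l *\<^sub>R proj (\<Omega> (m + 1))
       ((1 - g) *\<^sub>R x + g *\<^sub>R (\<Sum>i=1..m. \<beta> i *\<^sub>R proj (\<Omega> i) x))"

end

(* The solutions are the points x of K = Omega (m+1) with <x - M x, y - x> >= 0 for all y in K,
   where M is the weighted mean of the projections P_i; these are exactly the fixed points of the
   maps G. Existence follows from the intersection property of decreasing bounded closed convex
   sets, applied to sublevel sets. M strictly decreases distances from points outside a strictly
   convex Omega s, which gives uniqueness. In finite dimension Halpern's iteration (under Wittmann's
   conditions on the steering parameters) converges to P_i, and does so uniformly on the compact
   set K because all iterates are nonexpansive. The x^k are therefore a vanishing perturbation
   of an iteration whose distance to x* strictly decreases on the compact set K. *)
theory Submission
  imports Defs
begin

section \<open>Projections in a Hilbert space\<close>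

text \<open>The gradient of the objective at \<open>x\<close> is
  \<open>x - mean_proj m \<beta> \<Omega> x\<close>, but no derivative is taken: an affine minorant
  and a majorant with remainder \<open>1/2 * (norm h)\<^sup>2\<close>, both built on this vector,
  give the variational inequality, and the minorant also gives the convexity of the sublevel sets.
  Strict convexity yields a strict inequality without a contraction factor, so Banach's fixed point
  theorem is out of reach. On a compact set the decrease of the distance is still bounded below away
  from the solution, which is why a perturbation that merely tends to 0, without rate or
  summability, is tolerated. Uniformity of the inner convergence matters because the inner algorithm
  starts from the moving point \<open>x k\<close> while its number of steps grows. Finite dimension
  is given as a finite spanning set; compactness of bounded closed sets is derived from it through
  an orthogonal basis and serves both the inner cluster point argument and the outer
  iteration.\<close>

lemma infdist_less_obtain:
  assumes "S \<noteq> {}" "infdist x S < r"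
  obtains y where "y \<in> S" "dist x y < r"
  using assms cInf_lessD[of "dist x ` S" r] by (auto simp: infdist_notempty)

text \<open>The squared distances \<open>r n\<close> from 0 to \<open>C n\<close> increase and are
  bounded, hence Cauchy. Almost nearest points \<open>p n\<close> of \<open>C n\<close> then form a
  Cauchy sequence: for \<open>i \<le> j\<close> the midpoint of \<open>p i\<close> and
  \<open>p j\<close> lies in \<open>C i\<close>, so the parallelogram identity controls their
  distance. This takes the place of weak compactness, both for nearest points and for
  minimizers.\<close>

lemma decseq_convex_Inter_nonempty:
  fixes C :: "nat \<Rightarrow> 'a::{real_inner,complete_space} set"
  assumes C: "\<And>n. C n \<noteq> {}" "\<And>n. closed (C n)" "\<And>n. convex (C n)"
    and dec: "decseq C" and bdd: "bounded (C 0)"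
  shows "(\<Inter>n. C n) \<noteq> {}"
proof -
  define r where "r n = (infdist 0 (C n))\<^sup>2" for n
  have r_le: "r n \<le> (norm x)\<^sup>2" if "x \<in> C n" for n x
    unfolding r_def using infdist_le[OF that, of 0] infdist_nonneg[of 0 "C n"]
    by (intro power_mono) auto
  have inc: "incseq r"
    unfolding r_def incseq_def using dec C(1)
    by (auto simp: decseq_def infdist_nonneg intro!: power_mono infdist_mono)
  obtain B where B: "\<And>x. x \<in> C 0 \<Longrightarrow> norm x \<le> B"
    using bdd by (auto simp: bounded_iff)
  have r_bound: "r n \<le> B\<^sup>2" for n
  proof -
    obtain x where x: "x \<in> C n" using C(1) by blast
    then have "x \<in> C 0" using dec by (auto simp: decseq_def)
    then have "(norm x)\<^sup>2 \<le> B\<^sup>2" using B by (intro power_mono) auto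
    with r_le[OF x] show ?thesis by linarith
  qed
  then have "convergent r"
    using inc by (metis incseq_convergent convergentI)
  then have rC: "Cauchy r" by (rule convergent_Cauchy)
  have "\<exists>x\<in>C n. (norm x)\<^sup>2 < r n + inverse (Suc n)" for n
  proof -
    have "infdist 0 (C n) < sqrt (r n + inverse (Suc n))"
      unfolding r_def by (rule real_less_rsqrt) auto
    then obtain x where x: "x \<in> C n" "norm x < sqrt (r n + inverse (Suc n))"
      using infdist_less_obtain[OF C(1)] by (metis dist_0_norm)
    have "r n \<ge> 0" by (simp add: r_def)
    then have "(norm x)\<^sup>2 < (sqrt (r n + inverse (Suc n)))\<^sup>2"
      using x(2) by (intro power_strict_mono) auto
    with x(1) \<open>r n \<ge> 0\<close> show ?thesis by (auto intro!: bexI[of _ x])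
  qed
  then obtain p where p: "\<And>n. p n \<in> C n" "\<And>n. (norm (p n))\<^sup>2 < r n + inverse (Suc n)"
    by metis
  have par: "(dist (p i) (p j))\<^sup>2 \<le> 2 * (r j - r i) + 4 * inverse (Suc i)" if "i \<le> j" for i j
  proof -
    have "p j \<in> C i" using p(1)[of j] dec that by (auto simp: decseq_def)
    then have "(1/2) *\<^sub>R p i + (1/2) *\<^sub>R p j \<in> C i"
      using C(3)[of i] p(1)[of i] by (auto simp: convex_def)
    from r_le[OF this] have "4 * r i \<le> (norm (p i + p j))\<^sup>2"
      by (simp add: scaleR_add_right[symmetric] power_divide)
    moreover have "(dist (p i) (p j))\<^sup>2 = 2 * (norm (p i))\<^sup>2 + 2 * (norm (p j))\<^sup>2 - (norm (p i + p j))\<^sup>2"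
      by (simp add: dist_norm power2_norm_eq_inner inner_add_left inner_add_right inner_diff_left inner_diff_right inner_commute)
    moreover have "inverse (real (Suc j)) \<le> inverse (real (Suc i))"
      using that by (simp add: field_simps)
    ultimately show ?thesis using p(2)[of i] p(2)[of j] by argo
  qed
  have "Cauchy p"
  proof (rule CauchyI')
    fix e :: real assume e: "e > 0"
    \<comment> \<open>The estimate \<open>par\<close> then stays below
      \<open>2 * (e\<^sup>2 / 8) + 4 * (e\<^sup>2 / 8)\<close>, which is less than
      \<open>e\<^sup>2\<close>.\<close>
    then have e2: "e\<^sup>2 / 8 > 0" by simp
    obtain M1 where M1: "\<forall>i\<ge>M1. \<forall>j\<ge>M1. dist (r i) (r j) < e\<^sup>2 / 8"
      using rC e2 unfolding Cauchy_def by metis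
    obtain M2 where M2: "inverse (real (Suc M2)) < e\<^sup>2 / 8"
      using reals_Archimedean[OF e2] by blast
    show "\<exists>M. \<forall>m\<ge>M. \<forall>n>m. dist (p m) (p n) < e"
    proof (intro exI allI impI)
      fix i j assume ij: "max M1 M2 \<le> i" "i < j"
      have "\<bar>r j - r i\<bar> < e\<^sup>2 / 8"
        using M1[rule_format, of j i] ij by (simp add: dist_real_def del: divide_less_eq_numeral1 less_divide_eq_numeral1)
      moreover have "inverse (real (Suc i)) < e\<^sup>2 / 8"
      proof (rule order.strict_trans1[OF _ M2])
        show "inverse (real (Suc i)) \<le> inverse (real (Suc M2))"
          using ij by (intro le_imp_inverse_le) auto
      qed
      ultimately have "(dist (p i) (p j))\<^sup>2 < e\<^sup>2" using par[OF less_imp_le[OF ij(2)]] by argo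
      then show "dist (p i) (p j) < e"
        using e by (auto intro: power2_less_imp_less)
    qed
  qed
  then obtain l where l: "p \<longlonglongrightarrow> l" using Cauchy_convergent convergent_def by blast
  have "l \<in> C n" for n
    using C(2)
  proof (rule Lim_in_closed_set[OF _ _ _ l])
    show "eventually (\<lambda>k. p k \<in> C n) sequentially"
      using p(1) dec unfolding eventually_sequentially decseq_def by blast
  qed auto
  then show ?thesis by blast
qed

text \<open>Moving from \<open>y\<close> towards \<open>z\<close> by a fraction \<open>t\<close>
  changes the squared distance to \<open>x\<close> by
  \<open>- 2 * t * ((x - y) \<bullet> (z - y))\<close> plus a term of order
  \<open>t\<^sup>2\<close>; dividing by \<open>t\<close> and letting \<open>t\<close> tend to 0
  gives one direction. The other expands the square of \<open>x - z\<close> around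
  \<open>y\<close>.\<close>

lemma obtuse_iff_nearest:
  fixes S :: "'a::real_inner set"
  assumes "convex S" "y \<in> S"
  shows "dist x y = infdist x S \<longleftrightarrow> (\<forall>z\<in>S. (x - y) \<bullet> (z - y) \<le> 0)"
proof
  assume d: "dist x y = infdist x S"
  show "\<forall>z\<in>S. (x - y) \<bullet> (z - y) \<le> 0"
  proof
    fix z assume z: "z \<in> S"
    have "2 * ((x - y) \<bullet> (z - y)) \<le> t * (norm (z - y))\<^sup>2" if t: "0 < t" "t < 1" for t
    proof -
      have "(1 - t) *\<^sub>R y + t *\<^sub>R z \<in> S"
        using assms z t by (intro convexD_alt) auto
      then have "dist x y \<le> dist x ((1 - t) *\<^sub>R y + t *\<^sub>R z)"
        unfolding d by (rule infdist_le)
      then have "(norm (x - y))\<^sup>2 \<le> (norm (x - y - t *\<^sub>R (z - y)))\<^sup>2"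
        by (intro power_mono) (auto simp: dist_norm algebra_simps)
      also have "\<dots> = (norm (x - y))\<^sup>2 - t * (2 * ((x - y) \<bullet> (z - y))) + t * (t * (norm (z - y))\<^sup>2)"
        unfolding power2_norm_eq_inner
        by (simp add: inner_diff_left inner_diff_right inner_commute algebra_simps)
      finally have "t * (2 * ((x - y) \<bullet> (z - y))) \<le> t * (t * (norm (z - y))\<^sup>2)" by linarith
      with t show ?thesis by simp
    qed
    then have "eventually (\<lambda>t. 2 * ((x - y) \<bullet> (z - y)) \<le> t * (norm (z - y))\<^sup>2) (at_right 0)"
      unfolding eventually_at_right_field by (intro exI[of _ 1]) auto
    moreover have "((\<lambda>t. t * (norm (z - y))\<^sup>2) \<longlongrightarrow> 0 * (norm (z - y))\<^sup>2) (at_right 0)"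
      by (intro tendsto_intros)
    ultimately have "2 * ((x - y) \<bullet> (z - y)) \<le> 0 * (norm (z - y))\<^sup>2"
      by (intro tendsto_lowerbound) auto
    then show "(x - y) \<bullet> (z - y) \<le> 0" by simp
  qed
next
  assume ob: "\<forall>z\<in>S. (x - y) \<bullet> (z - y) \<le> 0"
  have "dist x y \<le> dist x z" if "z \<in> S" for z
  proof -
    have "(norm (x - z))\<^sup>2 = (norm (x - y))\<^sup>2 - 2 * ((x - y) \<bullet> (z - y)) + (norm (z - y))\<^sup>2"
      by (simp add: power2_norm_eq_inner inner_add_left inner_add_right inner_diff_left inner_diff_right inner_commute)
    moreover have "(x - y) \<bullet> (z - y) \<le> 0" "0 \<le> (norm (z - y))\<^sup>2" using ob that by auto
    ultimately have "(norm (x - y))\<^sup>2 \<le> (norm (x - z))\<^sup>2" by linarith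
    then show ?thesis by (simp add: dist_norm)
  qed
  then have "dist x y \<le> infdist x S"
    using assms(2) by (subst infdist_notempty) (auto intro!: cINF_greatest)
  then show "dist x y = infdist x S" using infdist_le[OF assms(2), of x] by simp
qed

text \<open>Each inequality is tested at the other point; their sum is
  \<open>(y - y') \<bullet> (y - y') \<le> 0\<close>.\<close>

lemma obtuse_unique:
  fixes x :: "'a::real_inner"
  assumes "y \<in> S" "\<And>z. z \<in> S \<Longrightarrow> (x - y) \<bullet> (z - y) \<le> 0"
    and "y' \<in> S" "\<And>z. z \<in> S \<Longrightarrow> (x - y') \<bullet> (z - y') \<le> 0"
  shows "y = y'"
proof -
  have "(x - y) \<bullet> (y' - y) + (x - y') \<bullet> (y - y') \<le> 0"
    using assms by (meson add_nonpos_nonpos)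
  then have "(y - y') \<bullet> (y - y') \<le> 0"
    by (simp add: inner_add_left inner_add_right inner_diff_left inner_diff_right inner_commute)
  then show ?thesis by (metis inner_ge_zero inner_eq_zero_iff eq_iff_diff_eq_0 order_antisym)
qed

text \<open>Any common point of the intersections of \<open>S\<close> with closed balls about
  \<open>x\<close> whose radii shrink to \<open>infdist x S\<close> is nearest.\<close>

lemma nearest_point_exists:
  fixes S :: "'a::{real_inner,complete_space} set"
  assumes S: "S \<noteq> {}" "closed S" "convex S"
  shows "\<exists>y\<in>S. dist x y = infdist x S"
proof -
  define C where "C n = S \<inter> cball x (infdist x S + inverse (Suc n))" for n
  have "(\<Inter>n. C n) \<noteq> {}"
  proof (rule decseq_convex_Inter_nonempty)
    fix n
    have "infdist x S < infdist x S + inverse (Suc n)" by simp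
    then obtain y where "y \<in> S" "dist x y < infdist x S + inverse (Suc n)"
      using infdist_less_obtain[OF S(1)] by metis
    then show "C n \<noteq> {}" unfolding C_def by force
    show "closed (C n)" "convex (C n)" using S by (auto simp: C_def convex_Int)
    show "bounded (C 0)" by (auto simp: C_def bounded_Int)
    have "cball x (infdist x S + inverse (Suc j)) \<subseteq> cball x (infdist x S + inverse (Suc i))"
      if "i \<le> j" for i j
      using that by (intro subset_cball add_left_mono le_imp_inverse_le) auto
    then show "decseq C" unfolding C_def decseq_def by blast
  qed
  then obtain y where y: "\<And>n. y \<in> C n" by blast
  have "(\<lambda>n. infdist x S + inverse (real (Suc n))) \<longlonglongrightarrow> infdist x S + 0"
    by (intro tendsto_add tendsto_const LIMSEQ_inverse_real_of_nat)
  then have "dist x y \<le> infdist x S + 0"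
    using y by (intro LIMSEQ_le_const) (auto simp: C_def)
  moreover have "y \<in> S" using y by (auto simp: C_def)
  ultimately show ?thesis using infdist_le[of y S x] by (intro bexI[of _ y]) auto
qed

context
  fixes S :: "'a::{real_inner,complete_space} set"
  assumes S: "S \<noteq> {}" "closed S" "convex S"
begin

lemma proj_in_dist: "proj S x \<in> S \<and> dist x (proj S x) = infdist x S"
  unfolding proj_def
proof (rule theI')
  obtain y where "y \<in> S" "dist x y = infdist x S" using nearest_point_exists S by blast
  then show "\<exists>!y. y \<in> S \<and> dist x y = infdist x S"
    by (metis S(3) obtuse_iff_nearest obtuse_unique)
qed

lemma proj_in: "proj S x \<in> S"
  and dist_proj: "dist x (proj S x) = infdist x S"
  using proj_in_dist by auto

lemma proj_obtuse: "z \<in> S \<Longrightarrow> (x - proj S x) \<bullet> (z - proj S x) \<le> 0"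
  using obtuse_iff_nearest[OF S(3) proj_in] dist_proj by blast

lemma proj_eq_iff: "proj S x = y \<longleftrightarrow> y \<in> S \<and> (\<forall>z\<in>S. (x - y) \<bullet> (z - y) \<le> 0)"
  using proj_in proj_obtuse obtuse_unique by metis

lemma infdist_eq_norm: "infdist x S = norm (x - proj S x)"
  by (metis dist_proj dist_norm)

text \<open>Sum of the obtuse angle inequality at \<open>x\<close> tested with
  \<open>proj S y\<close> and the one with \<open>x\<close> and \<open>y\<close> exchanged.\<close>

lemma proj_firmly_nonexpansive:
  "(norm (proj S x - proj S y))\<^sup>2 \<le> (x - y) \<bullet> (proj S x - proj S y)"
proof -
  have "(x - proj S x) \<bullet> (proj S y - proj S x) + (y - proj S y) \<bullet> (proj S x - proj S y) \<le> 0"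
    using proj_obtuse proj_in by (meson add_nonpos_nonpos)
  then show ?thesis
    by (simp add: power2_norm_eq_inner inner_add_left inner_add_right inner_diff_left inner_diff_right inner_commute)
qed

lemma proj_nonexpansive: "norm (proj S x - proj S y) \<le> norm (x - y)"
proof -
  have "norm (proj S x - proj S y) * norm (proj S x - proj S y)
      \<le> norm (x - y) * norm (proj S x - proj S y)"
    using proj_firmly_nonexpansive[of x y] norm_cauchy_schwarz[of "x - y" "proj S x - proj S y"]
    by (simp add: power2_eq_square)
  then show ?thesis
    by (cases "proj S x = proj S y") (auto simp: mult_le_cancel_right)
qed

text \<open>By firm nonexpansiveness, equality forces \<open>x\<close> and \<open>y\<close> to have
  the same residual \<open>v\<close>, nonzero since \<open>x\<close> lies outside \<open>S\<close>.
  The two projections differ, so their midpoint is interior to \<open>S\<close> and can be pushed a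
  little along \<open>v\<close> inside \<open>S\<close>, against the obtuse angle
  inequalities.\<close>

lemma proj_strictly_nonexpansive:
  assumes sc: "strictly_convex S" and xy: "x \<notin> S" "x \<noteq> y"
  shows "norm (proj S x - proj S y) < norm (x - y)"
proof (rule ccontr)
  let ?p = "proj S x" and ?q = "proj S y"
  assume "\<not> ?thesis"
  then have eq: "norm (?p - ?q) = norm (x - y)" using proj_nonexpansive[of x y] by simp
  have "(norm ((x - ?p) - (y - ?q)))\<^sup>2 = (norm (x - y))\<^sup>2 + (norm (?p - ?q))\<^sup>2 - 2 * ((x - y) \<bullet> (?p - ?q))"
    by (simp add: power2_norm_eq_inner inner_add_left inner_add_right inner_diff_left inner_diff_right inner_commute)
  also have "\<dots> \<le> 0" using proj_firmly_nonexpansive[of x y] eq by simp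
  finally have v: "x - ?p = y - ?q" by simp
  define v where "v = x - ?p"
  have "v \<noteq> 0" using xy proj_in[of x] by (auto simp: v_def)
  have pq: "?p \<noteq> ?q" using eq xy by auto
  define c where "c = midpoint ?p ?q"
  have "c \<in> interior S"
    using sc pq proj_in[of x] proj_in[of y] midpoint_in_open_segment[of ?p ?q]
    unfolding strictly_convex_def c_def by blast
  then obtain e where e: "e > 0" "cball c e \<subseteq> S" by (auto simp: mem_interior_cball)
  \<comment> \<open>The offsets of the midpoint from \<open>?p\<close> and \<open>?q\<close> cancel,
    so the sum of the two obtuse angle inequalities at \<open>z\<close> only sees the push along
    \<open>v\<close>.\<close>
  define z where "z = c + (e / norm v) *\<^sub>R v"
  have "z \<in> S" using e \<open>v \<noteq> 0\<close> by (auto simp: z_def dist_norm intro!: subsetD[OF e(2)])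
  have "v \<bullet> (z - ?p) + v \<bullet> (z - ?q) \<le> 0"
    using proj_obtuse[OF \<open>z \<in> S\<close>, of x] proj_obtuse[OF \<open>z \<in> S\<close>, of y] v by (simp add: v_def)
  moreover have "v \<bullet> (z - ?p) + v \<bullet> (z - ?q) = 2 * (e / norm v) * (v \<bullet> v)"
  proof -
    have "(z - ?p) + (z - ?q) = (2 * (e / norm v)) *\<^sub>R v"
      unfolding z_def c_def midpoint_def
      by (simp add: algebra_simps flip: scaleR_2)
    then show ?thesis by (metis inner_add_right inner_scaleR_right)
  qed
  moreover have "2 * (e / norm v) * (v \<bullet> v) > 0" using e \<open>v \<noteq> 0\<close> by simp
  ultimately show False by linarith
qed

text \<open>\<open>x - proj S x\<close> is the gradient of half the squared distance to \<open>S\<close>.\<close>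

lemma infdist_square_lower:
  "(infdist x S)\<^sup>2 + 2 * ((x - proj S x) \<bullet> (y - x)) \<le> (infdist y S)\<^sup>2"
proof -
  let ?a = "x - proj S x" and ?b = "y - proj S y"
  have "?a \<bullet> (proj S y - proj S x) \<le> 0" using proj_obtuse proj_in by blast
  moreover have "?a \<bullet> (?b - ?a) = ?a \<bullet> (y - x) - ?a \<bullet> (proj S y - proj S x)"
    by (simp add: inner_diff_left inner_diff_right)
  moreover have "(norm ?b)\<^sup>2 = (norm ?a)\<^sup>2 + 2 * (?a \<bullet> (?b - ?a)) + (norm (?b - ?a))\<^sup>2"
    by (simp add: power2_norm_eq_inner inner_add_left inner_add_right inner_diff_left inner_diff_right inner_commute)
  moreover have "(norm (?b - ?a))\<^sup>2 \<ge> 0" by simp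
  ultimately show ?thesis unfolding infdist_eq_norm by argo
qed

text \<open>The old projection \<open>proj S x\<close> is a competitor for the distance from
  \<open>x + h\<close>.\<close>

lemma infdist_square_upper:
  "(infdist (x + h) S)\<^sup>2 \<le> (infdist x S)\<^sup>2 + 2 * ((x - proj S x) \<bullet> h) + (norm h)\<^sup>2"
proof -
  have "(infdist (x + h) S)\<^sup>2 \<le> (dist (x + h) (proj S x))\<^sup>2"
    using infdist_le[OF proj_in] by (intro power_mono infdist_nonneg) auto
  also have "\<dots> = (norm (x - proj S x))\<^sup>2 + 2 * ((x - proj S x) \<bullet> h) + (norm h)\<^sup>2"
    by (simp add: dist_norm power2_norm_eq_inner inner_add_left inner_add_right inner_diff_left inner_diff_right inner_commute)
  finally show ?thesis by (simp add: infdist_eq_norm)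
qed

end

section \<open>Finite-dimensional inner product spaces\<close>

text \<open>The residual is orthogonal to \<open>C\<close> and lies in its span, hence is orthogonal
  to itself. \<open>C\<close> may contain 0: division by zero yields 0, so such a term
  vanishes.\<close>

lemma orthogonal_expansion:
  fixes x :: "'a::real_inner"
  assumes C: "finite C" "pairwise orthogonal C" "x \<in> span C"
  shows "x = (\<Sum>c\<in>C. ((x \<bullet> c) / (c \<bullet> c)) *\<^sub>R c)"
proof -
  let ?s = "\<Sum>c\<in>C. ((x \<bullet> c) / (c \<bullet> c)) *\<^sub>R c"
  have "orthogonal (x - ?s) b" if b: "b \<in> C" for b
  proof -
    have "?s \<bullet> b = (\<Sum>c\<in>C. if c = b then x \<bullet> b else 0)"
      unfolding inner_sum_left
      using C(2) b by (intro sum.cong) (auto simp: pairwise_def orthogonal_def)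
    then show ?thesis using C(1) b by (simp add: orthogonal_def inner_diff_left)
  qed
  then have "orthogonal (x - ?s) (x - ?s)"
  proof (rule orthogonal_to_span[rotated])
    show "x - ?s \<in> span C"
      by (intro span_diff C(3) span_sum span_scale) (rule span_base)
  qed
  then show ?thesis by (simp add: orthogonal_self)
qed

text \<open>Adding a vector to \<open>C\<close> turns the set into the Minkowski sum of a segment
  and the previous set.\<close>

lemma compact_sum_segments:
  fixes f :: "'b \<Rightarrow> 'a::real_normed_vector"
  assumes "finite C"
  shows "compact {\<Sum>c\<in>C. t c *\<^sub>R f c | t. \<forall>c\<in>C. \<bar>t c\<bar> \<le> R c}"
  using assms
proof (induction C)
  case empty
  then show ?case by simp
next
  case (insert a C)
  let ?A = "(\<lambda>s. s *\<^sub>R f a) ` {- R a..R a}"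
  let ?B = "{\<Sum>c\<in>C. t c *\<^sub>R f c | t. \<forall>c\<in>C. \<bar>t c\<bar> \<le> R c}"
  have "{\<Sum>c\<in>insert a C. t c *\<^sub>R f c | t. \<forall>c\<in>insert a C. \<bar>t c\<bar> \<le> R c}
      = {x + y | x y. x \<in> ?A \<and> y \<in> ?B}" (is "?L = ?R")
  proof
    show "?L \<subseteq> ?R"
    proof clarify
      fix t assume t: "\<forall>c\<in>insert a C. \<bar>t c\<bar> \<le> R c"
      have "(\<Sum>c\<in>insert a C. t c *\<^sub>R f c) = t a *\<^sub>R f a + (\<Sum>c\<in>C. t c *\<^sub>R f c)"
        using insert.hyps by simp
      moreover have "t a *\<^sub>R f a \<in> ?A" using t by (auto simp: abs_le_iff)
      moreover have "(\<Sum>c\<in>C. t c *\<^sub>R f c) \<in> ?B" using t by blast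
      ultimately show "\<exists>x y. (\<Sum>c\<in>insert a C. t c *\<^sub>R f c) = x + y \<and> x \<in> ?A \<and> y \<in> ?B"
        by blast
    qed
    show "?R \<subseteq> ?L"
    proof clarify
      fix s t assume s: "s \<in> {- R a..R a}" and t: "\<forall>c\<in>C. \<bar>t c\<bar> \<le> R c"
      have "(\<Sum>c\<in>C. (t(a := s)) c *\<^sub>R f c) = (\<Sum>c\<in>C. t c *\<^sub>R f c)"
        using insert.hyps by (intro sum.cong) auto
      with s t insert.hyps
      show "\<exists>t'. s *\<^sub>R f a + (\<Sum>c\<in>C. t c *\<^sub>R f c) = (\<Sum>c\<in>insert a C. t' c *\<^sub>R f c)
          \<and> (\<forall>c\<in>insert a C. \<bar>t' c\<bar> \<le> R c)"
        by (intro exI[of _ "t(a := s)"]) (auto simp: abs_le_iff)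
    qed
  qed
  moreover have "compact ?A" by (intro compact_continuous_image continuous_intros) auto
  ultimately show ?case using compact_sums[OF _ insert.IH] by simp
qed

text \<open>The coefficients in an orthogonal spanning set are bounded on \<open>S\<close>, so
  \<open>S\<close> is a closed subset of a compact box.\<close>

lemma finite_dim_bounded_closed_imp_compact:
  fixes S :: "'a::real_inner set"
  assumes B: "finite B" "span B = (UNIV :: 'a set)" and S: "bounded S" "closed S"
  shows "compact S"
proof -
  obtain C :: "'a set" where C: "finite C" "span C = UNIV" "pairwise orthogonal C"
    using basis_orthogonal[OF B(1)] B(2) by metis
  obtain r where r: "\<And>x. x \<in> S \<Longrightarrow> norm x \<le> r" using S(1) by (auto simp: bounded_iff)
  let ?K = "{\<Sum>c\<in>C. t c *\<^sub>R c | t. \<forall>c\<in>C. \<bar>t c\<bar> \<le> r / norm c}"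
  have "S \<subseteq> ?K"
  proof
    fix x assume x: "x \<in> S"
    \<comment> \<open>For \<open>c = 0\<close> both quotients are 0 by convention; otherwise this is
      Cauchy-Schwarz.\<close>
    have "\<bar>(x \<bullet> c) / (c \<bullet> c)\<bar> \<le> r / norm c" for c
    proof (cases "c = 0")
      case False
      have "\<bar>x \<bullet> c\<bar> \<le> norm x * norm c" by (rule Cauchy_Schwarz_ineq2)
      also have "\<dots> \<le> r * norm c" using r[OF x] by (intro mult_right_mono) auto
      finally show ?thesis
        using False by (simp add: dot_square_norm power2_eq_square field_simps)
    qed simp
    then show "x \<in> ?K"
      using orthogonal_expansion[OF C(1,3), of x] C(2) by auto
  qed
  then have "?K \<inter> S = S" by blast
  then show ?thesis
    using compact_Int_closed[OF compact_sum_segments[OF C(1), of "\<lambda>c. c" "\<lambda>c. r / norm c"] S(2)]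
    by simp
qed

section \<open>Halpern's anchored iteration\<close>

text \<open>The assumption on \<open>b\<close> says that its limit superior is at most 0. The lemma
  serves twice in Halpern's argument: with \<open>b = 0\<close> for the differences of consecutive
  iterates and with \<open>d = 0\<close> for the squared distances to the limit.\<close>

lemma recursive_inequality_tendsto_zero:
  fixes a b d t :: "nat \<Rightarrow> real"
  assumes a: "\<And>k. 0 \<le> a k" and t: "\<And>k. 0 \<le> t k" "\<And>k. t k \<le> 1"
    and div: "filterlim (\<lambda>n. \<Sum>k<n. t k) at_top sequentially"
    and d: "\<And>k. 0 \<le> d k" "summable d"
    and b: "\<And>e. 0 < e \<Longrightarrow> \<forall>\<^sub>F k in sequentially. b k \<le> e"
    and step: "\<And>k. a (Suc k) \<le> (1 - t k) * a k + t k * b k + d k"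
  shows "a \<longlonglongrightarrow> 0"
proof -
  have ev: "\<forall>\<^sub>F n in sequentially. a n < e" if e: "e > 0" for e
  proof -
    have e3: "e / 3 > 0" using e by simp
    obtain N1 where N1: "\<And>k. k \<ge> N1 \<Longrightarrow> b k \<le> e / 3"
      using b[OF e3] by (auto simp: eventually_sequentially)
    obtain N2 where N2: "\<And>n. n \<ge> N2 \<Longrightarrow> norm (\<Sum>i. d (i + n)) < e / 3"
      using suminf_exist_split[OF e3 d(2)] by blast
    define N where "N = max N1 N2"
    define A where "A = \<bar>a N\<bar>"
    \<comment> \<open>Subtracting the bound \<open>e / 3\<close> of \<open>b\<close> leaves a pure
      damping by \<open>1 - t k \<le> exp (- t k)\<close>; divergence of the sum of \<open>t\<close>
      then kills the initial value.\<close>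
    have main: "a (N + n) - e / 3 \<le> exp (- (\<Sum>k<n. t (N + k))) * A + (\<Sum>k<n. d (N + k))" for n
    proof (induction n)
      case 0
      then show ?case using e by (simp add: A_def)
    next
      case (Suc n)
      let ?E = "exp (- (\<Sum>k<n. t (N + k)))" and ?D = "\<Sum>k<n. d (N + k)" and ?t = "t (N + n)"
      have D: "?D \<ge> 0" using d by (simp add: sum_nonneg)
      have "?t * b (N + n) \<le> ?t * (e / 3)"
        using N1[of "N + n"] t(1) by (intro mult_left_mono) (auto simp: N_def)
      then have "a (N + Suc n) - e / 3 \<le> (1 - ?t) * (a (N + n) - e / 3) + d (N + n)"
        using step[of "N + n"] by (simp add: algebra_simps)
      also have "\<dots> \<le> (1 - ?t) * (?E * A + ?D) + d (N + n)"
        using Suc t(2) by (intro add_right_mono mult_left_mono) auto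
      also have "\<dots> = (1 - ?t) * (?E * A) + (1 - ?t) * ?D + d (N + n)"
        by (simp add: algebra_simps)
      also have "\<dots> \<le> exp (- ?t) * (?E * A) + 1 * ?D + d (N + n)"
        using exp_ge_add_one_self[of "- ?t"] t(1) D
        by (intro add_mono mult_right_mono) (auto simp: A_def)
      finally show ?case by (simp add: exp_add exp_diff exp_minus field_simps)
    qed
    have tail: "(\<Sum>k<n. d (N + k)) < e / 3" for n
    proof -
      have "(\<Sum>k<n. d (N + k)) \<le> (\<Sum>k. d (N + k))"
        using d summable_ignore_initial_segment[OF d(2), of N]
        by (intro sum_le_suminf) (auto simp: add.commute)
      also have "\<dots> < e / 3" using N2[of N] by (simp add: N_def add.commute)
      finally show ?thesis .
    qed
    have "filterlim (\<lambda>n. \<Sum>k<n. t (N + k)) at_top sequentially"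
    proof -
      have "(\<Sum>k<N + n. t k) = (\<Sum>k<N. t k) + (\<Sum>k<n. t (N + k))" for n
        by (induction n) auto
      moreover have "filterlim (\<lambda>n. \<Sum>k<N + n. t k) at_top sequentially"
        using filterlim_compose[OF div filterlim_add_const_nat_at_top[of N]] by (simp add: add.commute)
      ultimately have *: "filterlim (\<lambda>n. (\<Sum>k<N. t k) + (\<Sum>k<n. t (N + k))) at_top sequentially"
        by simp
      show ?thesis
        using filterlim_tendsto_add_at_top[OF tendsto_const[of "- (\<Sum>k<N. t k)"] *] by simp
    qed
    then have "(\<lambda>n. exp (- (\<Sum>k<n. t (N + k))) * A) \<longlonglongrightarrow> 0 * A"
      by (intro tendsto_mult tendsto_const
          filterlim_compose[OF exp_at_bot] filterlim_compose[OF filterlim_uminus_at_bot_at_top])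
    then have "\<forall>\<^sub>F n in sequentially. exp (- (\<Sum>k<n. t (N + k))) * A < e / 3"
      using e3 by (intro order_tendstoD(2)) auto
    then have "\<forall>\<^sub>F n in sequentially. a (n + N) < e"
    proof eventually_elim
      case (elim n)
      then show ?case using main[of n] tail[of n] by (simp add: add.commute)
    qed
    then show ?thesis by (rule eventually_sequentially_seg[THEN iffD1])
  qed
  then show ?thesis
    using a by (intro order_tendstoI) (auto intro!: always_eventually intro: less_le_trans)
qed

text \<open>The second part of \<open>q\<close> says that \<open>q\<close> is the fixed point
  nearest to the anchor \<open>x\<close>. All iterates stay in the ball of radius
  \<open>norm (x - q)\<close> about \<open>q\<close>. Consecutive differences vanish, so
  \<open>y t - T (y t)\<close> does too and cluster points are fixed points; hence
  \<open>(x - q) \<bullet> (y t - q)\<close> has limit superior at most 0, which drives the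
  recursion for the squared distance.\<close>

lemma halpern_tendsto:
  fixes T :: "'a::real_inner \<Rightarrow> 'a"
  assumes ne: "\<And>u v. norm (T u - T v) \<le> norm (u - v)"
    and q: "T q = q" "\<And>z. T z = z \<Longrightarrow> (x - q) \<bullet> (z - q) \<le> 0"
    and s: "steering_sequence s"
    and cpt: "compact (cball q (norm (x - q)))"
    and y0: "y 0 = x" and ySuc: "\<And>t. y (Suc t) = s t *\<^sub>R x + (1 - s t) *\<^sub>R T (y t)"
  shows "y \<longlonglongrightarrow> q"
proof -
  let ?R = "norm (x - q)"
  have s01: "0 < s t" "s t < 1" for t
    using s by (auto simp: steering_sequence_def)
  have s0: "s \<longlonglongrightarrow> 0"
    and sdiv: "filterlim (\<lambda>n. \<Sum>k<n. s k) at_top sequentially"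
    and ssum: "summable (\<lambda>k. \<bar>s (Suc k) - s k\<bar>)"
    using s by (auto simp: steering_sequence_def)
  have Tq: "norm (T u - q) \<le> norm (u - q)" for u using ne[of u q] q(1) by simp
  have yR: "norm (y t - q) \<le> ?R" for t
  proof (induction t)
    case (Suc t)
    have "y (Suc t) - q = s t *\<^sub>R (x - q) + (1 - s t) *\<^sub>R (T (y t) - q)"
      by (simp add: ySuc algebra_simps)
    then have "norm (y (Suc t) - q) \<le> s t * ?R + (1 - s t) * norm (T (y t) - q)"
      using s01[of t] by (metis abs_of_pos diff_gt_0_iff_gt norm_scaleR norm_triangle_ineq)
    also have "\<dots> \<le> s t * ?R + (1 - s t) * ?R"
      using s01[of t] Tq[of "y t"] Suc by (intro add_left_mono mult_left_mono) auto
    finally show ?case by (simp add: algebra_simps)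
  qed (simp add: y0)
  have xT: "norm (x - T (y t)) \<le> 2 * ?R" for t
    using norm_triangle_ineq4[of "x - q" "T (y t) - q"] Tq[of "y t"] yR[of t] by simp
  have "(\<lambda>t. norm (y (Suc t) - y t)) \<longlonglongrightarrow> 0"
  proof (rule recursive_inequality_tendsto_zero)
    let ?d = "\<lambda>t. 2 * ?R * \<bar>s (Suc t) - s t\<bar>"
    show "summable ?d" using ssum by (rule summable_mult)
    have "filterlim (\<lambda>n. \<Sum>k<Suc n. s k) at_top sequentially"
      using filterlim_compose[OF sdiv filterlim_Suc] by simp
    then have *: "filterlim (\<lambda>n. s 0 + (\<Sum>k<n. s (Suc k))) at_top sequentially"
      by (simp add: sum.lessThan_Suc_shift del: sum.lessThan_Suc)
    show "filterlim (\<lambda>n. \<Sum>k<n. s (Suc k)) at_top sequentially"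
      using filterlim_tendsto_add_at_top[OF tendsto_const[of "- s 0"] *] by simp
    show "\<forall>\<^sub>F k in sequentially. (0::real) \<le> e" if "0 < e" for e using that by simp
    fix t
    show "0 \<le> s (Suc t)" "s (Suc t) \<le> 1" using s01[of "Suc t"] by auto
    \<comment> \<open>The change of the steering parameter is split off as a summable error; what
      remains is damped by \<open>1 - s (Suc t)\<close>.\<close>
    have "y (Suc (Suc t)) - y (Suc t) = (s (Suc t) - s t) *\<^sub>R (x - T (y t))
        + (1 - s (Suc t)) *\<^sub>R (T (y (Suc t)) - T (y t))"
      unfolding ySuc[of "Suc t"] ySuc[of t] by (simp add: algebra_simps)
    then have "norm (y (Suc (Suc t)) - y (Suc t)) \<le> \<bar>s (Suc t) - s t\<bar> * norm (x - T (y t))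
        + (1 - s (Suc t)) * norm (T (y (Suc t)) - T (y t))"
      using s01[of "Suc t"] norm_triangle_ineq
      by (metis abs_of_pos diff_gt_0_iff_gt norm_scaleR)
    also have "\<dots> \<le> \<bar>s (Suc t) - s t\<bar> * (2 * ?R) + (1 - s (Suc t)) * norm (y (Suc t) - y t)"
      using xT ne s01[of "Suc t"] by (intro add_mono mult_left_mono) auto
    finally show "norm (y (Suc (Suc t)) - y (Suc t))
        \<le> (1 - s (Suc t)) * norm (y (Suc t) - y t) + s (Suc t) * 0 + ?d t"
      by (simp add: algebra_simps)
  qed auto
  moreover have "(\<lambda>t. s t * (2 * ?R)) \<longlonglongrightarrow> 0" using tendsto_mult[OF s0 tendsto_const] by simp
  ultimately have "(\<lambda>t. norm (y (Suc t) - y t) + s t * (2 * ?R)) \<longlonglongrightarrow> 0"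
    using tendsto_add by fastforce
  moreover have "norm (y t - T (y t)) \<le> norm (y (Suc t) - y t) + s t * (2 * ?R)" for t
  proof -
    have "y t - T (y t) = s t *\<^sub>R (x - T (y t)) - (y (Suc t) - y t)"
      by (simp add: ySuc algebra_simps)
    then have "norm (y t - T (y t)) \<le> s t * norm (x - T (y t)) + norm (y (Suc t) - y t)"
      using s01[of t] by (metis abs_of_pos norm_scaleR norm_triangle_ineq4)
    moreover have "s t * norm (x - T (y t)) \<le> s t * (2 * ?R)"
      using xT s01[of t] by (intro mult_left_mono) auto
    ultimately show ?thesis by linarith
  qed
  ultimately have "(\<lambda>t. norm (y t - T (y t))) \<longlonglongrightarrow> 0"
    by (intro Lim_null_comparison[of "\<lambda>t. norm (y t - T (y t))"]) auto
  then have reg: "(\<lambda>t. y t - T (y t)) \<longlonglongrightarrow> 0" by (simp add: tendsto_norm_zero_iff)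
  have contT: "isCont T u" for u
    unfolding isCont_def
  proof (rule LIM_I)
    fix r :: real assume "r > 0"
    then show "\<exists>e>0. \<forall>v. v \<noteq> u \<and> norm (v - u) < e \<longrightarrow> norm (T v - T u) < r"
      using ne by (meson order.strict_trans1)
  qed
  \<comment> \<open>Otherwise some subsequence stays above \<open>e\<close>, and its cluster point
    would be a fixed point violating \<open>q(2)\<close>.\<close>
  have limsup: "\<forall>\<^sub>F t in sequentially. (x - q) \<bullet> (y t - q) \<le> e" if e: "e > 0" for e
  proof (rule ccontr)
    assume "\<not> ?thesis"
    then have "infinite {t. (x - q) \<bullet> (y t - q) > e}"
      unfolding not_eventually not_le by (simp add: frequently_cofinite cofinite_eq_sequentially[symmetric])
    then obtain r :: "nat \<Rightarrow> nat" where r: "strict_mono r" "\<And>n. (x - q) \<bullet> (y (r n) - q) > e"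
      using infinite_enumerate by blast
    have "\<forall>n. (y \<circ> r) n \<in> cball q ?R" using yR by (auto simp: dist_norm norm_minus_commute)
    then obtain l r' where l: "strict_mono r'" "((y \<circ> r) \<circ> r') \<longlonglongrightarrow> l"
      using cpt unfolding compact_def by metis
    have sm: "strict_mono (r \<circ> r')" using r l strict_mono_o by blast
    have 1: "(\<lambda>n. y ((r \<circ> r') n)) \<longlonglongrightarrow> l" using l(2) by (simp add: o_def)
    have 2: "(\<lambda>n. T (y ((r \<circ> r') n))) \<longlonglongrightarrow> T l" using contT 1 by (rule isCont_tendsto_compose)
    have 3: "(\<lambda>n. y ((r \<circ> r') n) - T (y ((r \<circ> r') n))) \<longlonglongrightarrow> 0"
      using LIMSEQ_subseq_LIMSEQ[OF reg sm] by (simp add: o_def)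
    have "l - T l = 0" using tendsto_diff[OF 1 2] 3 LIMSEQ_unique by blast
    then have "(x - q) \<bullet> (l - q) \<le> 0" using q(2) by simp
    moreover have "e \<le> (x - q) \<bullet> (l - q)"
    proof (rule LIMSEQ_le_const)
      show "(\<lambda>n. (x - q) \<bullet> (y ((r \<circ> r') n) - q)) \<longlonglongrightarrow> (x - q) \<bullet> (l - q)"
        by (intro tendsto_intros 1)
    qed (use r(2) in \<open>auto intro: less_imp_le\<close>)
    ultimately show False using e by simp
  qed
  have "(\<lambda>t. (norm (y t - q))\<^sup>2) \<longlonglongrightarrow> 0"
  proof (rule recursive_inequality_tendsto_zero)
    let ?b = "\<lambda>t. 2 * ((x - q) \<bullet> (y (Suc t) - q))"
    show "\<forall>\<^sub>F t in sequentially. ?b t \<le> e" if "0 < e" for e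
    proof -
      have "\<forall>\<^sub>F t in sequentially. (x - q) \<bullet> (y (Suc t) - q) \<le> e / 2"
        using limsup[of "e / 2"] that by (subst eventually_sequentially_Suc) auto
      then show ?thesis by eventually_elim simp
    qed
    fix t
    show "0 \<le> s t" "s t \<le> 1" using s01[of t] by auto
    \<comment> \<open>Since \<open>?v = ?u + s t *\<^sub>R (x - q)\<close>, the inequality \<open>2
      * (?u \<bullet> ?v) \<le> ?u \<bullet> ?u + ?v \<bullet> ?v\<close> gives \<open>?v \<bullet>
      ?v \<le> ?u \<bullet> ?u + 2 * s t * ((x - q) \<bullet> ?v)\<close>.\<close>
    let ?u = "(1 - s t) *\<^sub>R (T (y t) - q)" and ?v = "y (Suc t) - q"
    have "s t *\<^sub>R (x - q) = ?v - ?u" by (simp add: ySuc algebra_simps)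
    then have "s t * ((x - q) \<bullet> ?v) = ?v \<bullet> ?v - ?u \<bullet> ?v"
      by (metis inner_diff_left inner_scaleR_left)
    moreover have "2 * (a \<bullet> b) \<le> a \<bullet> a + b \<bullet> b" for a b :: 'a
      using inner_ge_zero[of "a - b"] by (simp add: inner_diff_left inner_diff_right inner_commute)
    then have "2 * (?u \<bullet> ?v) \<le> ?u \<bullet> ?u + ?v \<bullet> ?v" .
    moreover have "?u \<bullet> ?u \<le> (1 - s t) * (norm (y t - q))\<^sup>2"
    proof -
      have "?u \<bullet> ?u = (1 - s t) * ((1 - s t) * (norm (T (y t) - q))\<^sup>2)"
        by (simp add: power2_norm_eq_inner)
      also have "\<dots> \<le> (1 - s t) * (1 * (norm (y t - q))\<^sup>2)"
        using s01[of t] Tq[of "y t"] by (intro mult_left_mono mult_mono power_mono) auto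
      finally show ?thesis by simp
    qed
    moreover have "s t * ?b t = 2 * (s t * ((x - q) \<bullet> ?v))" by simp
    ultimately show "(norm ?v)\<^sup>2 \<le> (1 - s t) * (norm (y t - q))\<^sup>2 + s t * ?b t + 0"
      unfolding power2_norm_eq_inner[of ?v] by argo
  qed (use sdiv in auto)
  from tendsto_real_sqrt[OF this] have "(\<lambda>t. norm (y t - q)) \<longlonglongrightarrow> 0" by simp
  then show ?thesis by (simp add: tendsto_norm_zero_iff LIM_zero_iff)
qed

section \<open>Weighted means of projections\<close>

text \<open>The operator occurs on two levels: with the weights \<open>w i\<close> inside the
  approximate projections, and with \<beta> in \<open>G_map\<close> and in the gradient of the
  objective.\<close>

definition mean_proj ::
  "nat \<Rightarrow> (nat \<Rightarrow> real) \<Rightarrow> (nat \<Rightarrow> 'a::{real_inner,complete_space} set) \<Rightarrow> 'a \<Rightarrow> 'a" where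
  "mean_proj n w C x = (\<Sum>j=1..n. w j *\<^sub>R proj (C j) x)"

lemma norm_weighted_sum_le:
  assumes "positive_weights n w"
  shows "norm (\<Sum>j=1..n. w j *\<^sub>R u j) \<le> (\<Sum>j=1..n. w j * norm (u j))"
proof (rule sum_norm_le)
  fix j assume "j \<in> {1..n}"
  then have "0 < w j" using assms by (auto simp: positive_weights_def)
  then show "norm (w j *\<^sub>R u j) \<le> w j * norm (u j)" by simp
qed

lemma diff_weighted_sum:
  fixes x :: "'a::real_vector"
  assumes "positive_weights n w"
  shows "x - (\<Sum>j=1..n. w j *\<^sub>R u j) = (\<Sum>j=1..n. w j *\<^sub>R (x - u j))"
proof -
  have "(\<Sum>j=1..n. w j *\<^sub>R x) = x"
    using assms by (simp add: positive_weights_def flip: scaleR_sum_left)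
  then show ?thesis by (simp add: scaleR_diff_right sum_subtractf)
qed

locale weighted_convex_sets =
  fixes n :: nat and w :: "nat \<Rightarrow> real" and C :: "nat \<Rightarrow> 'a::{real_inner,complete_space} set"
  assumes weights: "positive_weights n w"
    and C: "\<And>j. j \<in> {1..n} \<Longrightarrow> C j \<noteq> {}" "\<And>j. j \<in> {1..n} \<Longrightarrow> closed (C j)"
      "\<And>j. j \<in> {1..n} \<Longrightarrow> convex (C j)"
begin

lemma w_pos: "j \<in> {1..n} \<Longrightarrow> 0 < w j"
  and w_sum: "(\<Sum>j=1..n. w j) = 1"
  using weights by (auto simp: positive_weights_def)

lemma w_nonneg: "j \<in> {1..n} \<Longrightarrow> 0 \<le> w j"
  by (rule less_imp_le) (rule w_pos)

lemma weighted_sum_mono: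
  "(\<And>j. j \<in> {1..n} \<Longrightarrow> f j \<le> g j) \<Longrightarrow> (\<Sum>j=1..n. w j * f j) \<le> (\<Sum>j=1..n. w j * g j)"
  by (intro sum_mono mult_left_mono w_nonneg)

lemma weighted_sum_const: "(\<Sum>j=1..n. w j *\<^sub>R x) = x" for x :: "'b::real_vector"
  by (simp only: w_sum scaleR_one flip: scaleR_sum_left)

lemma norm_mean_proj_diff_le:
  "norm (mean_proj n w C x - mean_proj n w C y) \<le> (\<Sum>j=1..n. w j * norm (proj (C j) x - proj (C j) y))"
  using norm_weighted_sum_le[OF weights]
  by (simp add: mean_proj_def flip: sum_subtractf scaleR_diff_right)

lemma mean_proj_nonexpansive: "norm (mean_proj n w C x - mean_proj n w C y) \<le> norm (x - y)"
proof -
  note norm_mean_proj_diff_le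
  also have "(\<Sum>j=1..n. w j * norm (proj (C j) x - proj (C j) y)) \<le> (\<Sum>j=1..n. w j * norm (x - y))"
    by (intro weighted_sum_mono proj_nonexpansive C)
  also have "\<dots> = norm (x - y)" by (metis mult_1 sum_distrib_right w_sum)
  finally show ?thesis .
qed

text \<open>All weights are positive, so one strict summand makes the whole sum strict.\<close>

lemma mean_proj_strictly_nonexpansive:
  assumes s: "s \<in> {1..n}" "strictly_convex (C s)" and x: "x \<notin> C s" "x \<noteq> y"
  shows "norm (mean_proj n w C x - mean_proj n w C y) < norm (x - y)"
proof -
  note norm_mean_proj_diff_le
  also have "(\<Sum>j=1..n. w j * norm (proj (C j) x - proj (C j) y)) < (\<Sum>j=1..n. w j * norm (x - y))"
  proof (rule sum_strict_mono_ex1)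
    show "\<forall>j\<in>{1..n}. w j * norm (proj (C j) x - proj (C j) y) \<le> w j * norm (x - y)"
      by (intro ballI mult_left_mono proj_nonexpansive C w_nonneg)
    show "\<exists>j\<in>{1..n}. w j * norm (proj (C j) x - proj (C j) y) < w j * norm (x - y)"
      using w_pos[OF s(1)] proj_strictly_nonexpansive[OF C[OF s(1)] s(2) x]
      by (intro bexI[OF _ s(1)] mult_strict_left_mono)
  qed simp
  also have "\<dots> = norm (x - y)" by (metis mult_1 sum_distrib_right w_sum)
  finally show ?thesis .
qed

lemma inner_diff_mean_proj:
  "(x - mean_proj n w C x) \<bullet> v = (\<Sum>j=1..n. w j * ((x - proj (C j) x) \<bullet> v))"
  by (simp only: mean_proj_def diff_weighted_sum[OF weights] inner_sum_left inner_scaleR_left)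

text \<open>For a common point \<open>p\<close>, each residual satisfies \<open>(norm (x - proj (C
  j) x))\<^sup>2 \<le> (x - proj (C j) x) \<bullet> (x - p)\<close>. The weighted sum of the right
  sides is 0 at a fixed point, so all residuals vanish. Thus Halpern's limit is the projection onto
  the intersection.\<close>

lemma mean_proj_fixed_iff:
  assumes p: "p \<in> (\<Inter>j\<in>{1..n}. C j)"
  shows "mean_proj n w C x = x \<longleftrightarrow> x \<in> (\<Inter>j\<in>{1..n}. C j)"
proof
  assume fix_x: "mean_proj n w C x = x"
  have ge: "(norm (x - proj (C j) x))\<^sup>2 \<le> (x - proj (C j) x) \<bullet> (x - p)" if j: "j \<in> {1..n}" for j
  proof -
    have "(x - proj (C j) x) \<bullet> (p - proj (C j) x) \<le> 0"
      using p j by (intro proj_obtuse C) auto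
    then show ?thesis
      by (simp add: power2_norm_eq_inner inner_diff_left inner_diff_right inner_commute)
  qed
  have "(\<Sum>j=1..n. w j * (norm (x - proj (C j) x))\<^sup>2) \<le> (\<Sum>j=1..n. w j * ((x - proj (C j) x) \<bullet> (x - p)))"
    using ge by (rule weighted_sum_mono)
  also have "\<dots> = (x - mean_proj n w C x) \<bullet> (x - p)"
    by (rule inner_diff_mean_proj[symmetric])
  finally have "(\<Sum>j=1..n. w j * (norm (x - proj (C j) x))\<^sup>2) \<le> 0" using fix_x by simp
  moreover have nn: "0 \<le> w j * (norm (x - proj (C j) x))\<^sup>2" if "j \<in> {1..n}" for j
    using w_pos[OF that] by simp
  ultimately have "(\<Sum>j=1..n. w j * (norm (x - proj (C j) x))\<^sup>2) = 0"
    by (intro antisym sum_nonneg)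
  then have "\<forall>j\<in>{1..n}. w j * (norm (x - proj (C j) x))\<^sup>2 = 0"
    using nn by (subst (asm) sum_nonneg_eq_0_iff) auto
  then have "x = proj (C j) x" if "j \<in> {1..n}" for j
    using w_pos[OF that] that by force
  then show "x \<in> (\<Inter>j\<in>{1..n}. C j)" using proj_in C by (metis INT_I)
next
  assume x: "x \<in> (\<Inter>j\<in>{1..n}. C j)"
  have "proj (C j) x = x" if "j \<in> {1..n}" for j
    using x that C[OF that] by (subst proj_eq_iff) auto
  then have "mean_proj n w C x = (\<Sum>j=1..n. w j *\<^sub>R x)" by (simp add: mean_proj_def)
  also have "\<dots> = x" by (rule weighted_sum_const)
  finally show "mean_proj n w C x = x" .
qed

lemma anchored_iter_Suc:
  "anchored_iter n C w t x (Suc k) = t k *\<^sub>R x + (1 - t k) *\<^sub>R mean_proj n w C (anchored_iter n C w t x k)"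
  unfolding mean_proj_def by (rule anchored_iter.simps(2))

text \<open>The anchors differ by \<open>x - y\<close> as well, so every step is a convex
  combination of two differences of norm at most \<open>norm (x - y)\<close>. The constant 1 is the
  same for all \<open>k\<close>, which later upgrades pointwise to uniform convergence.\<close>

lemma approx_proj_nonexpansive:
  assumes t: "\<And>k. 0 \<le> t k" "\<And>k. t k \<le> 1"
  shows "norm (approx_proj n C w t k x - approx_proj n C w t k y) \<le> norm (x - y)"
proof -
  let ?a = "anchored_iter n C w t"
  have "norm (?a x k - ?a y k) \<le> norm (x - y)" for k
  proof (induction k)
    case (Suc k)
    let ?u = "mean_proj n w C (?a x k) - mean_proj n w C (?a y k)"
    have "?a x (Suc k) - ?a y (Suc k) = t k *\<^sub>R (x - y) + (1 - t k) *\<^sub>R ?u"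
      by (simp only: anchored_iter_Suc scaleR_diff_right add_diff_add)
    then have "norm (?a x (Suc k) - ?a y (Suc k)) \<le> t k * norm (x - y) + (1 - t k) * norm ?u"
      using norm_triangle_ineq[of "t k *\<^sub>R (x - y)" "(1 - t k) *\<^sub>R ?u"] t[of k] by simp
    also have "\<dots> \<le> t k * norm (x - y) + (1 - t k) * norm (x - y)"
      using t[of k] order_trans[OF mean_proj_nonexpansive Suc]
      by (intro add_left_mono mult_left_mono) auto
    finally show ?case by (simp add: algebra_simps)
  qed simp
  then show ?thesis unfolding approx_proj_def .
qed

lemma approx_proj_tendsto:
  assumes ne: "(\<Inter>j\<in>{1..n}. C j) \<noteq> {}" and t: "steering_sequence t"
    and cpt: "\<And>r. compact (cball (0::'a) r)"
  shows "(\<lambda>k. approx_proj n C w t k x) \<longlonglongrightarrow> proj (\<Inter>j\<in>{1..n}. C j) x"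
proof -
  let ?D = "\<Inter>j\<in>{1..n}. C j"
  have D: "closed ?D" by (rule closed_INT) (use C(2) in blast)
  have D': "convex ?D" by (rule convex_INT) (use C(3) in blast)
  let ?q = "proj ?D x"
  have q: "?q \<in> ?D" using ne D D' by (rule proj_in)
  have "anchored_iter n C w t x \<longlonglongrightarrow> ?q"
  proof (rule halpern_tendsto[OF mean_proj_nonexpansive _ _ t])
    show "mean_proj n w C ?q = ?q" using mean_proj_fixed_iff[OF q] q by blast
    show "(x - ?q) \<bullet> (z - ?q) \<le> 0" if "mean_proj n w C z = z" for z
      using mean_proj_fixed_iff[OF q] that proj_obtuse[OF ne D D'] by blast
    show "compact (cball ?q (norm (x - ?q)))"
      using compact_translation[OF cpt, of ?q "norm (x - ?q)"] cball_translation[of ?q 0 "norm (x - ?q)"]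
      by simp
  qed (simp_all add: mean_proj_def)
  \<comment> \<open>Index \<open>k\<close> of the approximate projection is iterate
    \<open>k + 1\<close>.\<close>
  then show ?thesis unfolding approx_proj_def by (rule LIMSEQ_Suc)
qed

end

text \<open>An \<open>e / 3\<close> argument: the maps converge simultaneously at the finitely many
  centres of a net of \<open>K\<close>, and nonexpansiveness carries this over to the moving point
  \<open>x k\<close>.\<close>

lemma nonexpansive_tendsto_along_compact:
  fixes F :: "nat \<Rightarrow> 'a::real_normed_vector \<Rightarrow> 'a"
  assumes F: "\<And>k u v. norm (F k u - F k v) \<le> norm (u - v)"
    and P: "\<And>u v. norm (P u - P v) \<le> norm (u - v)"
    and lim: "\<And>u. (\<lambda>k. F k u) \<longlonglongrightarrow> P u"
    and K: "compact K" "\<And>k. x k \<in> K"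
  shows "(\<lambda>k. norm (F k (x k) - P (x k))) \<longlonglongrightarrow> 0"
proof (rule order_tendstoI)
  fix e :: real assume e: "0 < e"
  then have e3: "0 < e / 3" by simp
  obtain Z where Z: "finite Z" "K \<subseteq> (\<Union>z\<in>Z. ball z (e / 3))"
    using compactE_image[OF K(1), of K "\<lambda>z. ball z (e / 3)"] e3 by (metis UN_I centre_in_ball open_ball subsetI)
  have "\<forall>\<^sub>F k in sequentially. \<forall>z\<in>Z. dist (F k z) (P z) < e / 3"
    using Z(1) tendstoD[OF lim e3] by (intro eventually_ball_finite) auto
  then show "\<forall>\<^sub>F k in sequentially. norm (F k (x k) - P (x k)) < e"
  proof eventually_elim
    case (elim k)
    obtain z where z: "z \<in> Z" "norm (z - x k) < e / 3"
      using Z(2) K(2)[of k] by (auto simp: dist_norm)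
    have "norm (F k (x k) - P (x k)) = norm ((F k (x k) - F k z) + (F k z - P z) + (P z - P (x k)))"
      by simp
    also have "\<dots> \<le> norm (F k (x k) - F k z) + norm (F k z - P z) + norm (P z - P (x k))"
      by (meson add_mono norm_triangle_ineq norm_triangle_mono order_refl)
    also have "\<dots> < e / 3 + e / 3 + e / 3"
      using F[of k "x k" z] P[of z "x k"] z elim
      by (intro add_strict_mono) (auto simp: dist_norm norm_minus_commute)
    finally show ?case by simp
  qed
qed (auto intro!: always_eventually intro: less_le_trans)

section \<open>Perturbed iterations of a strictly quasi-nonexpansive map\<close>

text \<open>Outside a ball about \<open>p\<close>, \<phi> has a positive minimum on
  \<open>K\<close>, so far from \<open>p\<close> the distance eventually drops by a fixed amount per
  step; this cannot go on forever. Close to \<open>p\<close>, a small perturbation cannot throw the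
  next point far away.\<close>

lemma perturbed_decrease_tendsto:
  fixes x :: "nat \<Rightarrow> 'a::real_normed_vector" and \<phi> :: "'a \<Rightarrow> real"
  assumes K: "compact K" "\<And>k. x k \<in> K"
    and \<phi>: "continuous_on K \<phi>" "\<And>z. z \<in> K \<Longrightarrow> z \<noteq> p \<Longrightarrow> 0 < \<phi> z" "0 \<le> \<phi> p"
    and c: "\<And>k. 0 \<le> c k" "0 < a" "\<forall>\<^sub>F k in sequentially. a \<le> c k"
    and e: "e \<longlonglongrightarrow> 0"
    and step: "\<And>k. norm (x (Suc k) - p) \<le> norm (x k - p) - c k * \<phi> (x k) + e k"
  shows "x \<longlonglongrightarrow> p"
proof (rule LIMSEQ_I)
  fix r :: real assume "0 < r"
  define \<epsilon> where "\<epsilon> = r / 2"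
  have \<epsilon>: "0 < \<epsilon>" using \<open>0 < r\<close> by (simp add: \<epsilon>_def)
  let ?V = "\<lambda>k. norm (x k - p)"
  have \<phi>_nonneg: "0 \<le> \<phi> (x k)" for k using \<phi>(2)[OF K(2)] \<phi>(3) by (metis less_imp_le)
  have "\<exists>d>0. \<forall>z\<in>K - ball p \<epsilon>. d \<le> \<phi> z"
  proof (cases "K - ball p \<epsilon> = {}")
    case True
    then show ?thesis by (intro exI[of _ 1]) auto
  next
    case False
    have "compact (K - ball p \<epsilon>)" using K(1) by (intro compact_diff) auto
    then obtain u where u: "u \<in> K - ball p \<epsilon>" "\<forall>z\<in>K - ball p \<epsilon>. \<phi> u \<le> \<phi> z"
      using continuous_attains_inf[OF _ False continuous_on_subset[OF \<phi>(1)]] by blast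
    then have "u \<noteq> p" using \<epsilon> by auto
    then show ?thesis using \<phi>(2)[of u] u by (intro exI[of _ "\<phi> u"]) auto
  qed
  then obtain d where d: "0 < d" "\<And>z. z \<in> K \<Longrightarrow> \<epsilon> \<le> norm (z - p) \<Longrightarrow> d \<le> \<phi> z"
    by (auto simp: dist_norm norm_minus_commute)
  \<comment> \<open>The drop is at least \<open>a * d\<close>; half of it is reserved for absorbing
    the perturbation \<open>e k\<close>.\<close>
  define h where "h = a * d / 2"
  have h: "0 < h" using c(2) d(1) by (simp add: h_def)
  have "\<forall>\<^sub>F k in sequentially. a \<le> c k \<and> e k < h \<and> e k < \<epsilon>"
    using c(3) order_tendstoD(2)[OF e h] order_tendstoD(2)[OF e \<epsilon>] by eventually_elim simp
  then obtain N where N: "\<And>k. N \<le> k \<Longrightarrow> a \<le> c k \<and> e k < h \<and> e k < \<epsilon>"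
    by (auto simp: eventually_sequentially)
  have far: "?V (Suc k) \<le> ?V k - h" if k: "N \<le> k" "\<epsilon> \<le> ?V k" for k
  proof -
    have "a * d \<le> c k * \<phi> (x k)"
      using N[OF k(1)] d(2)[OF K(2) k(2)] c d(1) by (intro mult_mono) auto
    moreover have "e k < h" using N[OF k(1)] by simp
    ultimately show ?thesis using step[of k] unfolding h_def by linarith
  qed
  \<comment> \<open>Distances in \<open>[\<epsilon>, 2 * \<epsilon>)\<close> decrease; smaller ones
    grow by at most \<open>e k < \<epsilon>\<close>.\<close>
  have near: "?V (Suc k) < 2 * \<epsilon>" if k: "N \<le> k" "?V k < 2 * \<epsilon>" for k
  proof (cases "\<epsilon> \<le> ?V k")
    case True
    then show ?thesis using far k h by fastforce
  next
    case False
    have "0 \<le> c k * \<phi> (x k)" using c(1) \<phi>_nonneg by simp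
    then show ?thesis using step[of k] N[OF k(1)] False by linarith
  qed
  have "\<exists>k\<ge>N. ?V k < 2 * \<epsilon>"
  proof (rule ccontr)
    assume "\<not> ?thesis"
    then have big: "2 * \<epsilon> \<le> ?V k" if "N \<le> k" for k using that by force
    have "?V (N + j) \<le> ?V N - real j * h" for j
    proof (induction j)
      case (Suc j)
      have "?V (Suc (N + j)) \<le> ?V (N + j) - h" using big[of "N + j"] \<epsilon> by (intro far) auto
      with Suc show ?case by (simp add: algebra_simps)
    qed simp
    moreover obtain j where "?V N < real j * h" using reals_Archimedean3[OF h] by blast
    ultimately show False by (smt (verit) norm_ge_zero)
  qed
  then obtain k0 where k0: "N \<le> k0" "?V k0 < 2 * \<epsilon>" by blast
  have "?V k < 2 * \<epsilon>" if "k0 \<le> k" for k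
    using that
  proof (induction k rule: dec_induct)
    case (step j)
    then show ?case using near k0(1) by simp
  qed (rule k0(2))
  then show "\<exists>no. \<forall>k\<ge>no. norm (x k - p) < r" by (auto simp: \<epsilon>_def)
qed

section \<open>The proximity minimization problem\<close>

locale proximity_problem = weighted_convex_sets m \<beta> \<Omega>
  for m :: nat and \<beta> :: "nat \<Rightarrow> real" and \<Omega> :: "nat \<Rightarrow> 'a::{real_inner,complete_space} set" +
  assumes K: "\<Omega> (m + 1) \<noteq> {}" "closed (\<Omega> (m + 1))" "convex (\<Omega> (m + 1))"
begin

lemma proximity_lower:
  "proximity m \<Omega> \<beta> x + (x - mean_proj m \<beta> \<Omega> x) \<bullet> (y - x) \<le> proximity m \<Omega> \<beta> y"
proof -
  have "(\<Sum>i=1..m. \<beta> i * ((infdist x (\<Omega> i))\<^sup>2 + 2 * ((x - proj (\<Omega> i) x) \<bullet> (y - x))))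
      \<le> (\<Sum>i=1..m. \<beta> i * (infdist y (\<Omega> i))\<^sup>2)"
    by (intro weighted_sum_mono infdist_square_lower C)
  also have "(\<Sum>i=1..m. \<beta> i * ((infdist x (\<Omega> i))\<^sup>2 + 2 * ((x - proj (\<Omega> i) x) \<bullet> (y - x))))
      = (\<Sum>i=1..m. \<beta> i * (infdist x (\<Omega> i))\<^sup>2) + 2 * ((x - mean_proj m \<beta> \<Omega> x) \<bullet> (y - x))"
    unfolding inner_diff_mean_proj by (simp add: distrib_left sum.distrib sum_distrib_left mult.left_commute)
  finally show ?thesis unfolding proximity_def by argo
qed

lemma proximity_upper:
  "proximity m \<Omega> \<beta> (x + h)
    \<le> proximity m \<Omega> \<beta> x + (x - mean_proj m \<beta> \<Omega> x) \<bullet> h + 1/2 * (norm h)\<^sup>2"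
proof -
  have "(\<Sum>i=1..m. \<beta> i * (infdist (x + h) (\<Omega> i))\<^sup>2)
      \<le> (\<Sum>i=1..m. \<beta> i * ((infdist x (\<Omega> i))\<^sup>2 + 2 * ((x - proj (\<Omega> i) x) \<bullet> h) + (norm h)\<^sup>2))"
    by (intro weighted_sum_mono infdist_square_upper C)
  also have "\<dots> = (\<Sum>i=1..m. \<beta> i * (infdist x (\<Omega> i))\<^sup>2)
      + 2 * ((x - mean_proj m \<beta> \<Omega> x) \<bullet> h) + (\<Sum>i=1..m. \<beta> i) * (norm h)\<^sup>2"
    unfolding inner_diff_mean_proj
    by (simp add: distrib_left sum.distrib sum_distrib_left sum_distrib_right mult.left_commute)
  finally show ?thesis unfolding proximity_def w_sum by argo
qed

text \<open>Necessity applies the quadratic majorant along the segment to \<open>y\<close>, divides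
  by \<open>t\<close> and lets \<open>t\<close> tend to 0; sufficiency is the affine
  minorant.\<close>

lemma is_solution_iff:
  "is_solution m \<Omega> \<beta> x \<longleftrightarrow>
     x \<in> \<Omega> (m + 1) \<and> (\<forall>y\<in>\<Omega> (m + 1). 0 \<le> (x - mean_proj m \<beta> \<Omega> x) \<bullet> (y - x))"
  (is "_ \<longleftrightarrow> _ \<and> (\<forall>y\<in>_. 0 \<le> ?g \<bullet> (y - x))")
proof safe
  assume sol: "is_solution m \<Omega> \<beta> x"
  then show x: "x \<in> \<Omega> (m + 1)" by (simp add: is_solution_def is_arg_min_def)
  fix y assume y: "y \<in> \<Omega> (m + 1)"
  have "0 \<le> ?g \<bullet> (y - x) + t * (1/2 * (norm (y - x))\<^sup>2)" if t: "0 < t" "t < 1" for t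
  proof -
    have "x + t *\<^sub>R (y - x) \<in> \<Omega> (m + 1)"
      using convexD_alt[OF K(3) x y, of t] t by (simp add: algebra_simps)
    then have "proximity m \<Omega> \<beta> x \<le> proximity m \<Omega> \<beta> (x + t *\<^sub>R (y - x))"
      using sol by (auto simp: is_solution_def is_arg_min_def not_less)
    also note proximity_upper
    finally have "0 \<le> ?g \<bullet> (t *\<^sub>R (y - x)) + 1/2 * (norm (t *\<^sub>R (y - x)))\<^sup>2" by simp
    also have "\<dots> = t * (?g \<bullet> (y - x) + t * (1/2 * (norm (y - x))\<^sup>2))"
      by (simp only: norm_scaleR power_mult_distrib power2_abs inner_scaleR_right)
        (simp add: distrib_left power2_eq_square)
    finally have "0 \<le> t * (?g \<bullet> (y - x) + t * (1/2 * (norm (y - x))\<^sup>2))" .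
    with t show ?thesis by (simp add: zero_le_mult_iff)
  qed
  then have "\<forall>\<^sub>F t in at_right 0. 0 \<le> ?g \<bullet> (y - x) + t * (1/2 * (norm (y - x))\<^sup>2)"
    unfolding eventually_at_right_field by (intro exI[of _ 1]) auto
  moreover have "((\<lambda>t. ?g \<bullet> (y - x) + t * (1/2 * (norm (y - x))\<^sup>2))
      \<longlongrightarrow> ?g \<bullet> (y - x) + 0 * (1/2 * (norm (y - x))\<^sup>2)) (at_right 0)"
    by (intro tendsto_intros)
  ultimately have "0 \<le> ?g \<bullet> (y - x) + 0 * (1/2 * (norm (y - x))\<^sup>2)"
    by (intro tendsto_lowerbound) auto
  then show "0 \<le> ?g \<bullet> (y - x)" by simp
next
  assume x: "x \<in> \<Omega> (m + 1)" "\<forall>y\<in>\<Omega> (m + 1). 0 \<le> ?g \<bullet> (y - x)"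
  have "proximity m \<Omega> \<beta> x \<le> proximity m \<Omega> \<beta> y" if "y \<in> \<Omega> (m + 1)" for y
    using proximity_lower[of x y] x(2)[rule_format, OF that] by linarith
  with x(1) show "is_solution m \<Omega> \<beta> x"
    unfolding is_solution_def is_arg_min_def by (meson not_less)
qed

text \<open>The argument of the outer projection minus \<open>x\<close> is \<open>- g\<close> times
  the gradient, so the obtuse angle inequality at \<open>x\<close> is the variational inequality up
  to a positive factor. Hence the fixed points are the same for all parameters.\<close>

lemma G_map_fixed_iff:
  assumes "l \<noteq> 0" "0 < g"
  shows "G_map m \<Omega> \<beta> l g x = x \<longleftrightarrow> is_solution m \<Omega> \<beta> x"
proof -
  let ?z = "(1 - g) *\<^sub>R x + g *\<^sub>R mean_proj m \<beta> \<Omega> x"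
  have "G_map m \<Omega> \<beta> l g x - x = l *\<^sub>R (proj (\<Omega> (m + 1)) ?z - x)"
    by (simp add: G_map_def mean_proj_def algebra_simps)
  then have "G_map m \<Omega> \<beta> l g x = x \<longleftrightarrow> proj (\<Omega> (m + 1)) ?z = x"
    using assms(1) by (metis eq_iff_diff_eq_0 scaleR_eq_0_iff)
  also have "\<dots> \<longleftrightarrow> x \<in> \<Omega> (m + 1) \<and> (\<forall>y\<in>\<Omega> (m + 1). (?z - x) \<bullet> (y - x) \<le> 0)"
    by (rule proj_eq_iff[OF K])
  also have "?z - x = - (g *\<^sub>R (x - mean_proj m \<beta> \<Omega> x))" by (simp add: algebra_simps)
  finally show ?thesis
    unfolding is_solution_iff using assms(2) by (simp add: zero_le_mult_iff)
qed

text \<open>The sets \<open>S k\<close> are sublevel sets at levels decreasing to the infimum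
  \<open>I\<close>; a common point attains \<open>I\<close>.\<close>

lemma solution_exists:
  assumes bdd: "bounded (\<Omega> (m + 1)) \<or> (\<exists>q\<in>{1..m}. bounded (\<Omega> q))"
  shows "\<exists>x. is_solution m \<Omega> \<beta> x"
proof -
  let ?f = "proximity m \<Omega> \<beta>"
  define I where "I = Inf (?f ` \<Omega> (m + 1))"
  have f0: "0 \<le> ?f x" for x
    unfolding proximity_def
    by (intro mult_nonneg_nonneg sum_nonneg zero_le_power2 w_nonneg) auto
  then have bb: "bdd_below (?f ` \<Omega> (m + 1))" by (rule bdd_belowI2)
  define S where "S k = {x \<in> \<Omega> (m + 1). ?f x \<le> I + inverse (Suc k)}" for k
  have "(\<Inter>k. S k) \<noteq> {}"
  proof (rule decseq_convex_Inter_nonempty)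
    fix k
    show "S k \<noteq> {}"
    proof -
      have "Inf (?f ` \<Omega> (m + 1)) < I + inverse (Suc k)" by (simp add: I_def)
      then obtain x where "x \<in> \<Omega> (m + 1)" "?f x < I + inverse (Suc k)"
        using cInf_lessD[of "?f ` \<Omega> (m + 1)"] K(1) by auto
      then show ?thesis by (auto simp: S_def intro: less_imp_le)
    qed
    have "continuous_on UNIV ?f" unfolding proximity_def by (intro continuous_intros)
    then have "closed {x. ?f x \<le> I + inverse (Suc k)}"
      by (intro closed_Collect_le continuous_on_const)
    moreover have "S k = \<Omega> (m + 1) \<inter> {x. ?f x \<le> I + inverse (Suc k)}" by (auto simp: S_def)
    ultimately show "closed (S k)" using closed_Int[OF K(2)] by simp
    show "convex (S k)"
      unfolding convex_alt
    proof (intro ballI allI impI, elim conjE)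
      fix x y and u :: real assume xy: "x \<in> S k" "y \<in> S k" and u: "0 \<le> u" "u \<le> 1"
      let ?z = "(1 - u) *\<^sub>R x + u *\<^sub>R y" and ?g = "\<lambda>z. z - mean_proj m \<beta> \<Omega> z"
      \<comment> \<open>The slope terms cancel since \<open>?z\<close> is the convex combination; by
        the affine minorant at \<open>?z\<close>, the brackets are at most \<open>?f x\<close> and
        \<open>?f y\<close>.\<close>
      have "?f ?z = (1 - u) * (?f ?z + ?g ?z \<bullet> (x - ?z)) + u * (?f ?z + ?g ?z \<bullet> (y - ?z))"
      proof -
        have "(1 - u) *\<^sub>R (x - ?z) + u *\<^sub>R (y - ?z) = 0" by (simp add: algebra_simps)
        then have "?g ?z \<bullet> ((1 - u) *\<^sub>R (x - ?z) + u *\<^sub>R (y - ?z)) = 0" by simp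
        then have "(1 - u) * (?g ?z \<bullet> (x - ?z)) + u * (?g ?z \<bullet> (y - ?z)) = 0"
          by (simp only: inner_add_right inner_scaleR_right)
        then show ?thesis by argo
      qed
      also have "\<dots> \<le> (1 - u) * ?f x + u * ?f y"
        using u proximity_lower by (intro add_mono mult_left_mono) auto
      also have "\<dots> \<le> I + inverse (Suc k)"
        using xy u by (intro convex_bound_le) (auto simp: S_def)
      finally show "?z \<in> S k" using convexD_alt[OF K(3)] xy u by (auto simp: S_def)
    qed
    show "decseq S"
    proof (rule decseq_SucI)
      fix j
      have "inverse (real (Suc (Suc j))) \<le> inverse (real (Suc j))"
        by (intro le_imp_inverse_le) auto
      then show "S (Suc j) \<subseteq> S j" unfolding S_def by (blast intro: order_trans add_left_mono)
    qed
    show "bounded (S 0)"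
      using bdd
    proof
      assume "bounded (\<Omega> (m + 1))"
      then show ?thesis by (rule bounded_subset) (auto simp: S_def)
    next
      assume "\<exists>q\<in>{1..m}. bounded (\<Omega> q)"
      then obtain q B where q: "q \<in> {1..m}" and B: "\<And>y. y \<in> \<Omega> q \<Longrightarrow> norm y \<le> B"
        unfolding bounded_iff by blast
      \<comment> \<open>On \<open>S 0\<close> the objective is at most \<open>I + 1\<close>, since
        \<open>inverse (Suc 0) = 1\<close>, and the summand of index \<open>q\<close> alone is at
        most twice the objective.\<close>
      define r where "r = sqrt (2 * (I + 1) / \<beta> q)"
      have "norm x \<le> r + B" if x: "x \<in> S 0" for x
      proof -
        have "\<beta> q * (infdist x (\<Omega> q))\<^sup>2 \<le> (\<Sum>i=1..m. \<beta> i * (infdist x (\<Omega> i))\<^sup>2)"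
          using q by (intro member_le_sum mult_nonneg_nonneg zero_le_power2 w_nonneg) auto
        also have "\<dots> = 2 * ?f x" by (simp add: proximity_def)
        also have "\<dots> \<le> 2 * (I + 1)" using x by (simp add: S_def)
        finally have "(infdist x (\<Omega> q))\<^sup>2 \<le> 2 * (I + 1) / \<beta> q"
          using w_pos[OF q] by (simp add: field_simps)
        then have "infdist x (\<Omega> q) \<le> r" unfolding r_def by (rule real_le_rsqrt)
        then have "norm (x - proj (\<Omega> q) x) \<le> r" using infdist_eq_norm[OF C[OF q]] by simp
        moreover have "norm (proj (\<Omega> q) x) \<le> B" using proj_in[OF C[OF q]] by (rule B)
        ultimately show ?thesis using norm_triangle_ineq[of "x - proj (\<Omega> q) x" "proj (\<Omega> q) x"] by simp
      qed
      then show ?thesis by (auto simp: bounded_iff)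
    qed
  qed
  then obtain x where x: "\<And>k. x \<in> S k" by blast
  have "(\<lambda>k. I + inverse (real (Suc k))) \<longlonglongrightarrow> I + 0"
    by (intro tendsto_add tendsto_const LIMSEQ_inverse_real_of_nat)
  then have "?f x \<le> I + 0" using x by (intro LIMSEQ_le_const) (auto simp: S_def)
  moreover have "I \<le> ?f y" if "y \<in> \<Omega> (m + 1)" for y
    unfolding I_def using bb that by (intro cInf_lower) auto
  ultimately have "?f x \<le> ?f y" if "y \<in> \<Omega> (m + 1)" for y
    using that by fastforce
  moreover have "x \<in> \<Omega> (m + 1)" using x[of 0] by (simp add: S_def)
  ultimately have "is_solution m \<Omega> \<beta> x"
    unfolding is_solution_def is_arg_min_def by (meson not_less)
  then show ?thesis ..
qed

text \<open>Two solutions are fixed points of the map with parameters 1, 1, which is strictly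
  nonexpansive off \<open>\<Omega> s\<close>.\<close>

lemma solution_unique:
  assumes s: "s \<in> {1..m}" "strictly_convex (\<Omega> s)" "\<Omega> s \<inter> \<Omega> (m + 1) = {}"
    and x: "is_solution m \<Omega> \<beta> x" and y: "is_solution m \<Omega> \<beta> y"
  shows "x = y"
proof (rule ccontr)
  assume "x \<noteq> y"
  have G: "proj (\<Omega> (m + 1)) (mean_proj m \<beta> \<Omega> z) = z" if "is_solution m \<Omega> \<beta> z" for z
    using G_map_fixed_iff[of 1 1 z] that by (simp add: G_map_def mean_proj_def)
  have "x \<in> \<Omega> (m + 1)" using x by (simp add: is_solution_iff)
  then have "x \<notin> \<Omega> s" using s(3) by blast
  then have "norm (mean_proj m \<beta> \<Omega> x - mean_proj m \<beta> \<Omega> y) < norm (x - y)"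
    using s \<open>x \<noteq> y\<close> by (intro mean_proj_strictly_nonexpansive)
  moreover have "norm (x - y) \<le> norm (mean_proj m \<beta> \<Omega> x - mean_proj m \<beta> \<Omega> y)"
    using proj_nonexpansive[OF K] G[OF x] G[OF y] by metis
  ultimately show False by simp
qed

text \<open>Each step from \<open>x k\<close> is compared with the exact step from the fixed point
  \<open>p\<close>. The \<open>Q i k\<close> enter only through nonexpansiveness and pointwise
  convergence.\<close>

lemma approx_iteration_tendsto:
  assumes cpt: "compact (\<Omega> (m + 1))"
    and s: "s \<in> {1..m}" "strictly_convex (\<Omega> s)" "\<Omega> s \<inter> \<Omega> (m + 1) = {}"
    and p: "is_solution m \<Omega> \<beta> p"
    and Q: "\<And>i k u v. i \<in> {1..m} \<Longrightarrow> norm (Q i k u - Q i k v) \<le> norm (u - v)"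
      "\<And>i u. i \<in> {1..m} \<Longrightarrow> (\<lambda>k. Q i k u) \<longlonglongrightarrow> proj (\<Omega> i) u"
    and l: "\<And>k. 0 < l k \<and> l k \<le> 1" "l \<longlonglongrightarrow> linf" "0 < linf"
    and g: "\<And>k. 0 < g k \<and> g k \<le> 1" "g \<longlonglongrightarrow> ginf" "0 < ginf"
    and x0: "x 0 \<in> \<Omega> (m + 1)"
    and xSuc: "\<And>k. x (Suc k) = (1 - l k) *\<^sub>R x k + l k *\<^sub>R proj (\<Omega> (m + 1))
        ((1 - g k) *\<^sub>R x k + g k *\<^sub>R (\<Sum>i=1..m. \<beta> i *\<^sub>R Q i k (x k)))"
  shows "(\<forall>k. x k \<in> \<Omega> (m + 1)) \<and> x \<longlonglongrightarrow> p"
proof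
  let ?M = "mean_proj m \<beta> \<Omega>" and ?P = "proj (\<Omega> (m + 1))"
  have xK: "x k \<in> \<Omega> (m + 1)" for k
  proof (induction k)
    case (Suc k)
    then show ?case
      unfolding xSuc using l(1)[of k] by (intro convexD_alt K proj_in) auto
  qed (rule x0)
  then show "\<forall>k. x k \<in> \<Omega> (m + 1)" ..
  \<comment> \<open>\<open>p\<close> is fixed for every pair of parameters, so the pair of step
    \<open>k\<close> can be used although the iteration map varies.\<close>
  have pG: "p = (1 - l k) *\<^sub>R p + l k *\<^sub>R ?P ((1 - g k) *\<^sub>R p + g k *\<^sub>R ?M p)" for k
    using G_map_fixed_iff[of "l k" "g k" p] p l(1)[of k] g(1)[of k]
    by (simp add: G_map_def mean_proj_def)
  define \<phi> where "\<phi> z = norm (z - p) - norm (?M z - ?M p)" for z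
  define e where "e k = (\<Sum>i=1..m. \<beta> i * norm (Q i k (x k) - proj (\<Omega> i) (x k)))" for k
  have e_nonneg: "0 \<le> e k" for k
    unfolding e_def by (intro sum_nonneg mult_nonneg_nonneg norm_ge_zero w_nonneg)
  show "x \<longlonglongrightarrow> p"
  proof (rule perturbed_decrease_tendsto[OF cpt xK])
    show "continuous_on (\<Omega> (m + 1)) \<phi>"
    proof -
      have "continuous_on (\<Omega> (m + 1)) ?M"
      proof (rule continuous_onI)
        fix u and r :: real assume "0 < r"
        then show "\<exists>d>0. \<forall>v\<in>\<Omega> (m + 1). dist v u < d \<longrightarrow> dist (?M v) (?M u) \<le> r"
          using mean_proj_nonexpansive unfolding dist_norm by (meson less_imp_le order_trans)
      qed
      then show ?thesis unfolding \<phi>_def by (intro continuous_intros)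
    qed
    show "0 < \<phi> z" if "z \<in> \<Omega> (m + 1)" "z \<noteq> p" for z
    proof -
      have "z \<notin> \<Omega> s" using that s(3) by blast
      then show ?thesis
        unfolding \<phi>_def using mean_proj_strictly_nonexpansive[OF s(1,2) _ that(2)] by simp
    qed
    show "0 \<le> \<phi> p" by (simp add: \<phi>_def)
    show "0 \<le> l k * g k" for k using l(1)[of k] g(1)[of k] by simp
    \<comment> \<open>Half of the limit of \<open>l k * g k\<close> bounds these coefficients from
      below eventually.\<close>
    show "0 < linf * ginf / 2" using l(3) g(3) by simp
    have "linf * ginf / 2 < linf * ginf" using l(3) g(3) by simp
    then have "\<forall>\<^sub>F k in sequentially. linf * ginf / 2 < l k * g k"
      using order_tendstoD(1)[OF tendsto_mult[OF l(2) g(2)]] by blast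
    then show "\<forall>\<^sub>F k in sequentially. linf * ginf / 2 \<le> l k * g k"
      by eventually_elim simp
    have "(\<lambda>k. norm (Q i k (x k) - proj (\<Omega> i) (x k))) \<longlonglongrightarrow> 0" if i: "i \<in> {1..m}" for i
      by (rule nonexpansive_tendsto_along_compact[OF Q(1)[OF i] proj_nonexpansive[OF C[OF i]] Q(2)[OF i] cpt xK])
    then have "e \<longlonglongrightarrow> (\<Sum>i=1..m. \<beta> i * 0)"
      unfolding e_def by (intro tendsto_sum tendsto_mult tendsto_const)
    then show "e \<longlonglongrightarrow> 0" by simp
    fix k
    let ?y = "\<Sum>i=1..m. \<beta> i *\<^sub>R Q i k (x k)"
    let ?V = "norm (x k - p)"
    have lg: "0 < l k" "l k \<le> 1" "0 < g k" "g k \<le> 1" using l(1) g(1) by auto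
    have "?y - ?M (x k) = (\<Sum>i=1..m. \<beta> i *\<^sub>R (Q i k (x k) - proj (\<Omega> i) (x k)))"
      by (simp add: mean_proj_def sum_subtractf scaleR_diff_right)
    then have y: "norm (?y - ?M (x k)) \<le> e k"
      unfolding e_def
      using norm_weighted_sum_le[OF weights, of "\<lambda>i. Q i k (x k) - proj (\<Omega> i) (x k)"] by simp
    have "norm (?y - ?M p) \<le> norm (?y - ?M (x k)) + norm (?M (x k) - ?M p)"
      using norm_triangle_ineq[of "?y - ?M (x k)" "?M (x k) - ?M p"] by simp
    with y have y': "norm (?y - ?M p) \<le> e k + (?V - \<phi> (x k))" by (simp add: \<phi>_def)
    let ?a = "(1 - g k) *\<^sub>R x k + g k *\<^sub>R ?y" and ?b = "(1 - g k) *\<^sub>R p + g k *\<^sub>R ?M p"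
    have "?a - ?b = (1 - g k) *\<^sub>R (x k - p) + g k *\<^sub>R (?y - ?M p)" by (simp add: algebra_simps)
    then have "norm (?a - ?b) \<le> (1 - g k) * ?V + g k * norm (?y - ?M p)"
      using norm_triangle_ineq[of "(1 - g k) *\<^sub>R (x k - p)" "g k *\<^sub>R (?y - ?M p)"] lg by simp
    also have "\<dots> \<le> (1 - g k) * ?V + g k * (e k + (?V - \<phi> (x k)))"
      using y' lg by (intro add_left_mono mult_left_mono) auto
    finally have ab: "norm (?P ?a - ?P ?b) \<le> ?V - g k * \<phi> (x k) + g k * e k"
      using proj_nonexpansive[OF K, of ?a ?b] by (simp add: algebra_simps)
    have "x (Suc k) - p = x (Suc k) - ((1 - l k) *\<^sub>R p + l k *\<^sub>R ?P ?b)"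
      using pG[of k] by (rule arg_cong)
    also have "\<dots> = (1 - l k) *\<^sub>R (x k - p) + l k *\<^sub>R (?P ?a - ?P ?b)"
      by (simp only: xSuc scaleR_diff_right add_diff_add)
    finally have "norm (x (Suc k) - p) \<le> (1 - l k) * ?V + l k * norm (?P ?a - ?P ?b)"
      using norm_triangle_ineq[of "(1 - l k) *\<^sub>R (x k - p)" "l k *\<^sub>R (?P ?a - ?P ?b)"] lg by simp
    also have "\<dots> \<le> (1 - l k) * ?V + l k * (?V - g k * \<phi> (x k) + g k * e k)"
      using ab lg by (intro add_left_mono mult_left_mono) auto
    also have "\<dots> = ?V - l k * g k * \<phi> (x k) + (l k * g k) * e k" by (simp add: algebra_simps)
    also have "\<dots> \<le> ?V - l k * g k * \<phi> (x k) + 1 * e k"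
      using lg e_nonneg by (intro add_left_mono mult_right_mono mult_le_one) auto
    finally show "norm (x (Suc k) - p) \<le> ?V - l k * g k * \<phi> (x k) + e k" by simp
  qed
qed

end

theorem theorem3p4:
  fixes m :: nat and M :: "nat \<Rightarrow> nat"
    and \<Omega>\<Omega> :: "nat \<Rightarrow> nat \<Rightarrow> 'a::{real_inner,complete_space} set"
    and \<Omega> :: "nat \<Rightarrow> 'a set"
    and \<beta> :: "nat \<Rightarrow> real"
    and w \<tau> :: "nat \<Rightarrow> nat \<Rightarrow> real"
    and lam gam :: "nat \<Rightarrow> real"
  assumes nontrivial: "\<exists>v::'a. v \<noteq> 0"
    and m: "m \<ge> 1"
    and M: "\<forall>i\<in>{1..m}. M i \<ge> 1"
    and sets: "\<forall>i\<in>{1..m}. \<forall>j\<in>{1..M i}. closed (\<Omega>\<Omega> i j) \<and> convex (\<Omega>\<Omega> i j)"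
    and inter: "\<forall>i\<in>{1..m}. \<Omega> i = (\<Inter>j\<in>{1..M i}. \<Omega>\<Omega> i j) \<and> \<Omega> i \<noteq> {}"
    and last: "\<Omega> (m + 1) \<noteq> {}" "closed (\<Omega> (m + 1))" "convex (\<Omega> (m + 1))"
    and \<beta>: "positive_weights m \<beta>"
    and \<tau>: "\<forall>i\<in>{1..m}. steering_sequence (\<tau> i)"
    and w: "\<forall>i\<in>{1..m}. positive_weights (M i) (w i)"
    and lam: "\<forall>k. 0 < lam k \<and> lam k \<le> 1"
    and gam: "\<forall>k. 0 < gam k \<and> gam k \<le> 1"
  shows
    "((bounded (\<Omega> (m + 1)) \<or> (\<not> bounded (\<Omega> (m + 1)) \<and> (\<exists>q\<in>{1..m}. bounded (\<Omega> q))))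
       \<longrightarrow> (\<exists>x. is_solution m \<Omega> \<beta> x))
     \<and>
     ((bounded (\<Omega> (m + 1)) \<or> (\<not> bounded (\<Omega> (m + 1)) \<and> (\<exists>q\<in>{1..m}. bounded (\<Omega> q))))
       \<and> (\<exists>s\<in>{1..m}. strictly_convex (\<Omega> s) \<and> \<Omega> s \<inter> \<Omega> (m + 1) = {})
       \<longrightarrow> (\<exists>xs.
             (\<forall>x. is_solution m \<Omega> \<beta> x \<longleftrightarrow> x = xs)
             \<and> (\<forall>l g. 0 < l \<and> l \<le> 1 \<and> 0 < g \<and> g < 2
                   \<longrightarrow> (\<forall>x. G_map m \<Omega> \<beta> l g x = x \<longleftrightarrow> x = xs))
             \<and> ((\<exists>B::'a set. finite B \<and> span B = UNIV)
                 \<and> (\<exists>\<rho>>0. \<Omega> (m + 1) \<union> (\<Union>i\<in>{1..m}. \<Union>j\<in>{1..M i}. \<Omega>\<Omega> i j) \<subseteq> cball 0 \<rho>)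
                 \<and> (\<forall>i\<in>{1..m}. strictly_convex (\<Omega> i) \<and> \<Omega> i \<inter> \<Omega> (m + 1) = {})
                 \<and> (\<exists>lam_inf>0. lam \<longlonglongrightarrow> lam_inf)
                 \<and> (\<exists>gam_inf>0. gam \<longlonglongrightarrow> gam_inf)
                 \<longrightarrow> (\<forall>x::nat \<Rightarrow> 'a.
                       x 0 \<in> \<Omega> (m + 1)
                       \<and> (\<forall>k. x (Suc k) =
                             (1 - lam k) *\<^sub>R x k +
                             lam k *\<^sub>R proj (\<Omega> (m + 1))
                               ((1 - gam k) *\<^sub>R x k +
                                gam k *\<^sub>R (\<Sum>i=1..m. \<beta> i *\<^sub>R
                                   approx_proj (M i) (\<Omega>\<Omega> i) (w i) (\<tau> i) k (x k))))
                       \<longrightarrow> (\<forall>k. x k \<in> \<Omega> (m + 1)) \<and> x \<longlonglongrightarrow> xs))))"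
proof -
  have mem: "i \<in> {1..m} \<Longrightarrow> \<Omega> i = (\<Inter>j\<in>{1..M i}. \<Omega>\<Omega> i j) \<and> \<Omega> i \<noteq> {}" for i
    using inter by (rule bspec)
  have closed: "closed (\<Omega> i)" if i: "i \<in> {1..m}" for i
    using mem[OF i] sets i by (metis (no_types, lifting) closed_INT)
  have convex: "convex (\<Omega> i)" if i: "i \<in> {1..m}" for i
    using mem[OF i] sets i by (metis (no_types, lifting) convex_INT)
  interpret proximity_problem m \<beta> \<Omega>
    using \<beta> mem closed convex last by unfold_locales blast+
  have inner: "weighted_convex_sets (M i) (w i) (\<Omega>\<Omega> i)" if i: "i \<in> {1..m}" for i
  proof
    show "positive_weights (M i) (w i)" using w i by blast
    fix j assume "j \<in> {1..M i}"
    \<comment> \<open>Each set is nonempty because it contains the nonempty intersection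
      \<open>\<Omega> i\<close>.\<close>
    then show "\<Omega>\<Omega> i j \<noteq> {}" "closed (\<Omega>\<Omega> i j)" "convex (\<Omega>\<Omega> i j)"
      using mem[OF i] sets i by blast+
  qed
  let ?Q = "\<lambda>i. approx_proj (M i) (\<Omega>\<Omega> i) (w i) (\<tau> i)"
  have Q_nonexpansive: "norm (?Q i k u - ?Q i k v) \<le> norm (u - v)" if i: "i \<in> {1..m}" for i k u v
  proof (rule weighted_convex_sets.approx_proj_nonexpansive[OF inner[OF i]])
    show "0 \<le> \<tau> i t" "\<tau> i t \<le> 1" for t
      using \<tau> i by (auto simp: steering_sequence_def intro: less_imp_le)
  qed
  have Q_tendsto: "(\<lambda>k. ?Q i k u) \<longlonglongrightarrow> proj (\<Omega> i) u"
    if i: "i \<in> {1..m}" and cpt: "\<And>r. compact (cball (0::'a) r)" for i u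
  proof -
    have "(\<Inter>j\<in>{1..M i}. \<Omega>\<Omega> i j) \<noteq> {}" "steering_sequence (\<tau> i)"
      using mem[OF i] \<tau> i by metis+
    from weighted_convex_sets.approx_proj_tendsto[OF inner[OF i] this cpt]
    show ?thesis using mem[OF i] by metis
  qed
  have part3: "(\<forall>k. x k \<in> \<Omega> (m + 1)) \<and> x \<longlonglongrightarrow> xs"
    if xs: "is_solution m \<Omega> \<beta> xs"
      and B: "finite B" "span B = (UNIV :: 'a set)"
      and bound: "\<Omega> (m + 1) \<union> (\<Union>i\<in>{1..m}. \<Union>j\<in>{1..M i}. \<Omega>\<Omega> i j) \<subseteq> cball 0 \<rho>"
      and s: "\<forall>i\<in>{1..m}. strictly_convex (\<Omega> i) \<and> \<Omega> i \<inter> \<Omega> (m + 1) = {}"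
      and l: "lam \<longlonglongrightarrow> linf" "0 < linf" and g: "gam \<longlonglongrightarrow> ginf" "0 < ginf"
      and x: "x 0 \<in> \<Omega> (m + 1)"
        "\<forall>k. x (Suc k) = (1 - lam k) *\<^sub>R x k + lam k *\<^sub>R proj (\<Omega> (m + 1))
            ((1 - gam k) *\<^sub>R x k + gam k *\<^sub>R (\<Sum>i=1..m. \<beta> i *\<^sub>R ?Q i k (x k)))"
    for xs B \<rho> linf ginf x
  \<comment> \<open>Strict convexity and disjointness hold for all indices here; index 1 exists
    since \<open>m \<ge> 1\<close>.\<close>
  proof (rule approx_iteration_tendsto[of 1 xs ?Q lam linf gam ginf])
    have "bounded (\<Omega> (m + 1))" using bound by (meson bounded_cball bounded_subset Un_subset_iff)
    then show "compact (\<Omega> (m + 1))"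
      using finite_dim_bounded_closed_imp_compact[OF B] last(2) by blast
    show "1 \<in> {1..m}" using m by simp
    then show "strictly_convex (\<Omega> 1)" "\<Omega> 1 \<inter> \<Omega> (m + 1) = {}" using s by blast+
    have "compact (cball (0::'a) r)" for r
      using finite_dim_bounded_closed_imp_compact[OF B] by simp
    then show "(\<lambda>k. ?Q i k u) \<longlonglongrightarrow> proj (\<Omega> i) u" if "i \<in> {1..m}" for i u
      using Q_tendsto that by blast
  qed (use xs l g x lam gam Q_nonexpansive in blast)+
  show ?thesis (is "(?bdd \<longrightarrow> _) \<and> (?bdd \<and> ?strict \<longrightarrow> ?concl)")
  proof (intro conjI impI)
    show ex: "\<exists>x. is_solution m \<Omega> \<beta> x" if ?bdd using that by (intro solution_exists) blast
    assume "?bdd \<and> ?strict"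
    then obtain xs s where xs: "is_solution m \<Omega> \<beta> xs"
      and s: "s \<in> {1..m}" "strictly_convex (\<Omega> s)" "\<Omega> s \<inter> \<Omega> (m + 1) = {}"
      using ex by blast
    have uniq: "is_solution m \<Omega> \<beta> x \<longleftrightarrow> x = xs" for x
      using solution_unique[OF s] xs by blast
    show ?concl
    proof (rule exI[of _ xs], intro conjI)
      show "\<forall>x. is_solution m \<Omega> \<beta> x \<longleftrightarrow> x = xs" using uniq by blast
      show "\<forall>l g. 0 < l \<and> l \<le> 1 \<and> 0 < g \<and> g < 2 \<longrightarrow> (\<forall>x. G_map m \<Omega> \<beta> l g x = x \<longleftrightarrow> x = xs)"
        using G_map_fixed_iff uniq by simp
    qed (intro impI allI, elim conjE exE, rule part3[OF xs], assumption+)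
  qed
qed

end
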